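(* Let $A=\mathbb F_q[T]$, let $k=\mathbb F_{q^r}$ with the $A$-field structure in which $T$ maps to $0$, and let $\phi$ be the Drinfeld module of rank $r$ over $k$ given by $\phi_T=\tau^r$. Let $\mathfrak q_1,\dots,\mathfrak q_\ell\in A$ ($\ell\ge1$) be distinct monic irreducible polynomials of degree $m\ge1$, none equal to $T$. Let $t$ be an integer with $1\le t\le\ell r$, put $s=tm-1$, let $\mathcal M_s=\{0\}\cup\{u\in\operatorname{End}_k(\phi):u\ne0,\ \deg_\tau(u)\le s\}$, and let $$\mathcal C=\mathcal C^{\mathrm{MSRD}}_{s,\mathfrak q_1,\dots,\mathfrak q_\ell}=\bigl\{(u|_{\phi[\mathfrak q_1]},\dots,u|_{\phi[\mathfrak q_\ell]}):u\in\mathcal M_s\bigr\}\subseteq\operatorname{Mat}_{r\times r}(\mathbb F_{q^m})^\ell .$$ Then $\mathcal C$ is an additive MSRD code. More precisely, $$d_{SR}(\mathcal C)=\ell r-t+1\qquad\text{and}\qquad\dim_{\mathbb F_q}\mathcal C=mrt .$$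
   Context: $q$ is a prime power. The twisted polynomial ring $k\{\tau\}$ consists of polynomials $\sum a_i\tau^i$, $a_i\in k$, with $(a\tau^i)(b\tau^j)=ab^{q^i}\tau^{i+j}$; an element acts on $\overline k$ by $\sum a_i\tau^i:x\mapsto\sum a_ix^{q^i}$. The Drinfeld module $\phi$ is the $\mathbb F_q$-algebra homomorphism $A\to k\{\tau\}$, $a\mapsto\phi_a=a(\tau^r)$. $\operatorname{End}_k(\phi)=\{u\in k\{\tau\}:u\phi_a=\phi_au\ \forall a\in A\}$; here it equals $\mathbb F_{q^r}\{\tau\}$ (and coincides with the ring of endomorphisms over $\overline k$). For nonzero $a\in A$, $\phi[a]=\{\alpha\in\overline k:\phi_a(\alpha)=0\}$, an $A$-module via $b\cdot\alpha=\phi_b(\alpha)$. Since $\mathfrak q_i\ne T$, $\phi[\mathfrak q_i]\cong(A/\mathfrak q_i)^r\cong\mathbb F_{q^m}^r$; each endomorphism acts $A/\mathfrak q_i$-linearly on $\phi[\mathfrak q_i]$, and is represented as a matrix in $\operatorname{Mat}_{r\times r}(\mathbb F_{q^m})$ after choosing an isomorphism $A/\mathfrak q_i\cong\mathbb F_{q^m}$ and a basis (rank properties do not depend on the choices). For $X=(X_1,\dots,X_\ell)\in\operatorname{Mat}_{r\times r}(\mathbb F_{q^m})^\ell$, $\operatorname{wt}_{SR}(X)=\sum_i\operatorname{rk}(X_i)$ (ranks over $\mathbb F_{q^m}$). An additive sum-rank code is an $\mathbb F_q$-linear subspace $\mathcal C$; if nonzero, $d_{SR}(\mathcal C)=\min\{\operatorname{wt}_{SR}(X):0\neq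 X\in\mathcal C\}$. The additive sum-rank Singleton bound is $\dim_{\mathbb F_q}\mathcal C\le mr(\ell r-d_{SR}(\mathcal C)+1)$; a code attaining equality is called additive MSRD. *)

theory Defs
  imports "HOL-Algebra.Algebraic_Closure_Type" "HOL-Analysis.Analysis"
begin

unbundle no fps_syntax

text \<open>
  The type \<open>'f\<close> is the field with \<open>q\<close> elements, so that \<open>A\<close> is \<open>'f poly\<close>; \<open>'k\<close> is the field over
  which the Drinfeld module lives, with algebraic closure \<open>'k alg_closure\<close>; \<open>'e\<close> is the field
  with \<open>q ^ m\<close> elements over which matrices are written.
\<close>

definition unital_ring_hom :: "('a::comm_ring_1 \<Rightarrow> 'b::comm_ring_1) \<Rightarrow> bool" where
  "unital_ring_hom h \<longleftrightarrow> h 1 = 1 \<and> (\<forall>x y. h (x + y) = h x + h y) \<and> (\<forall>x y. h (x * y) = h x * h y)"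

text \<open>
  The twisted polynomial \<open>\<Sum>i. a\<^sub>i \<tau>\<^sup>i\<close> is represented by the polynomial with the same coefficients.
  Addition, zero, one and \<open>degree\<close> (here: the degree in \<open>\<tau>\<close>) are those of the type \<open>'k poly\<close>; only
  the product differs. In particular \<open>monom 1 n\<close> stands for \<open>\<tau>\<^sup>n\<close>.
\<close>

definition tw_mult :: "nat \<Rightarrow> 'k::field poly \<Rightarrow> 'k poly \<Rightarrow> 'k poly" where
  "tw_mult q u v =
     (\<Sum>i\<le>Polynomial.degree u. \<Sum>j\<le>Polynomial.degree v.
        Polynomial.monom (Polynomial.coeff u i * Polynomial.coeff v j ^ (q ^ i)) (i + j))"

definition tw_act :: "nat \<Rightarrow> 'k::field poly \<Rightarrow> 'k alg_closure \<Rightarrow> 'k alg_closure" where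
  "tw_act q u x = (\<Sum>i\<le>Polynomial.degree u. to_ac (Polynomial.coeff u i) * x ^ (q ^ i))"

text \<open>
  The map \<open>\<gamma>\<close> is the structure map of the \<open>A\<close>-field; its restriction to constants is the embedding
  of the field with \<open>q\<close> elements. The rank is the degree in \<open>\<tau>\<close> of the image of \<open>T\<close>.
\<close>

definition drinfeld_module ::
  "nat \<Rightarrow> ('f::field poly \<Rightarrow> 'k::field) \<Rightarrow> nat \<Rightarrow> ('f poly \<Rightarrow> 'k poly) \<Rightarrow> bool" where
  "drinfeld_module q \<gamma> r \<phi> \<longleftrightarrow>
     \<phi> 1 = 1 \<and>
     (\<forall>a b. \<phi> (a + b) = \<phi> a + \<phi> b) \<and>
     (\<forall>a b. \<phi> (a * b) = tw_mult q (\<phi> a) (\<phi> b)) \<and>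
     (\<forall>c. \<phi> [:c:] = [:\<gamma> [:c:]:]) \<and>
     (\<forall>a. Polynomial.coeff (\<phi> a) 0 = \<gamma> a) \<and>
     r \<ge> 1 \<and> Polynomial.degree (\<phi> [:0, 1:]) = r"

definition drinfeld_End :: "nat \<Rightarrow> ('f::field poly \<Rightarrow> 'k::field poly) \<Rightarrow> 'k poly set" where
  "drinfeld_End q \<phi> = {u. \<forall>a. tw_mult q u (\<phi> a) = tw_mult q (\<phi> a) u}"

definition torsion ::
  "nat \<Rightarrow> ('f::field poly \<Rightarrow> 'k::field poly) \<Rightarrow> 'f poly \<Rightarrow> 'k alg_closure set" where
  "torsion q \<phi> a = {\<alpha>. tw_act q (\<phi> a) \<alpha> = 0}"

text \<open>
  An isomorphism of \<open>A / (p)\<close> with the field \<open>'e\<close>, compatible with the embedding \<open>\<iota>\<close> of the field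
  with \<open>q\<close> elements, is given as the induced surjection from \<open>A\<close> with kernel \<open>(p)\<close>.
\<close>

definition residue_iso ::
  "('f::field \<Rightarrow> 'e::field) \<Rightarrow> 'f poly \<Rightarrow> ('f poly \<Rightarrow> 'e) \<Rightarrow> bool" where
  "residue_iso \<iota> p \<sigma> \<longleftrightarrow>
     unital_ring_hom \<sigma> \<and> (\<forall>c. \<sigma> [:c:] = \<iota> c) \<and> surj \<sigma> \<and> (\<forall>a. \<sigma> a = 0 \<longleftrightarrow> p dvd a)"

text \<open>
  Linear combination of \<open>\<beta>\<close> with coefficients in \<open>A\<close>. For \<open>\<beta>\<close> in the \<open>p\<close>-torsion it depends only
  on the coefficients modulo \<open>p\<close>.
\<close>

definition tors_comb ::
  "nat \<Rightarrow> ('f::field poly \<Rightarrow> 'k::field poly) \<Rightarrow> ('r::finite \<Rightarrow> 'k alg_closure) \<Rightarrow>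
     ('r \<Rightarrow> 'f poly) \<Rightarrow> 'k alg_closure" where
  "tors_comb q \<phi> \<beta> a = (\<Sum>x\<in>UNIV. tw_act q (\<phi> (a x)) (\<beta> x))"

definition torsion_basis ::
  "nat \<Rightarrow> ('f::field poly \<Rightarrow> 'k::field poly) \<Rightarrow> 'f poly \<Rightarrow> ('r::finite \<Rightarrow> 'k alg_closure) \<Rightarrow> bool" where
  "torsion_basis q \<phi> p \<beta> \<longleftrightarrow>
     range \<beta> \<subseteq> torsion q \<phi> p \<and>
     (\<forall>\<alpha>\<in>torsion q \<phi> p. \<exists>a. \<alpha> = tors_comb q \<phi> \<beta> a) \<and>
     (\<forall>a. tors_comb q \<phi> \<beta> a = 0 \<longrightarrow> (\<forall>x. p dvd a x))"

text \<open>
  Matrix of \<open>u\<close> acting on the torsion with basis \<open>\<beta>\<close>: column \<open>y\<close> holds the coordinates of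
  \<open>u (\<beta> y)\<close>. The coefficients picked by \<open>SOME\<close> are unique modulo \<open>p\<close>, hence so are their images
  under \<open>\<sigma>\<close>.
\<close>

definition endo_matrix ::
  "nat \<Rightarrow> ('f::field poly \<Rightarrow> 'k::field poly) \<Rightarrow> ('f poly \<Rightarrow> 'e::field) \<Rightarrow>
     ('r::finite \<Rightarrow> 'k alg_closure) \<Rightarrow> 'k poly \<Rightarrow> 'e ^ 'r ^ 'r" where
  "endo_matrix q \<phi> \<sigma> \<beta> u =
     (\<chi> x y. \<sigma> ((SOME a. tw_act q u (\<beta> y) = tors_comb q \<phi> \<beta> a) x))"

definition endo_le :: "nat \<Rightarrow> ('f::field poly \<Rightarrow> 'k::field poly) \<Rightarrow> nat \<Rightarrow> 'k poly set" where
  "endo_le q \<phi> s = {0} \<union> {u \<in> drinfeld_End q \<phi>. u \<noteq> 0 \<and> Polynomial.degree u \<le> s}"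

definition msrd_code ::
  "nat \<Rightarrow> ('f::field poly \<Rightarrow> 'k::field poly) \<Rightarrow> ('l::finite \<Rightarrow> 'f poly \<Rightarrow> 'e::field) \<Rightarrow>
     ('l \<Rightarrow> 'r::finite \<Rightarrow> 'k alg_closure) \<Rightarrow> nat \<Rightarrow> ('e ^ 'r ^ 'r ^ 'l) set" where
  "msrd_code q \<phi> \<sigma> \<beta> s = (\<lambda>u. \<chi> i. endo_matrix q \<phi> (\<sigma> i) (\<beta> i) u) ` endo_le q \<phi> s"

definition wt_SR :: "'e::field ^ 'r::finite ^ 'r ^ 'l::finite \<Rightarrow> nat" where
  "wt_SR M = (\<Sum>i\<in>UNIV. rank (M $ i))"

definition d_SR :: "('e::field ^ 'r::finite ^ 'r ^ 'l::finite) set \<Rightarrow> nat" where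
  "d_SR C = Min (wt_SR ` (C - {0}))"

definition base_scale ::
  "('f::field \<Rightarrow> 'e::field) \<Rightarrow> 'f \<Rightarrow> 'e ^ 'r::finite ^ 'r ^ 'l::finite \<Rightarrow> 'e ^ 'r ^ 'r ^ 'l" where
  "base_scale \<iota> c M = (\<chi> i x y. \<iota> c * M $ i $ x $ y)"

definition additive_code ::
  "('f::field \<Rightarrow> 'e::field) \<Rightarrow> ('e ^ 'r::finite ^ 'r ^ 'l::finite) set \<Rightarrow> bool" where
  "additive_code \<iota> C \<longleftrightarrow> module.subspace (base_scale \<iota>) C"

definition base_dim ::
  "('f::field \<Rightarrow> 'e::field) \<Rightarrow> ('e ^ 'r::finite ^ 'r ^ 'l::finite) set \<Rightarrow> nat" where
  "base_dim \<iota> C = vector_space.dim (base_scale \<iota>) C"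

text \<open>
  Here \<open>m\<close> is the degree of \<open>'e\<close> over the base field. Since ranks are at most \<open>CARD('r)\<close>, the
  distance is at most \<open>CARD('l) * CARD('r)\<close> and the subtraction does not truncate.
\<close>

definition additive_MSRD ::
  "('f::field \<Rightarrow> 'e::field) \<Rightarrow> nat \<Rightarrow> ('e ^ 'r::finite ^ 'r ^ 'l::finite) set \<Rightarrow> bool" where
  "additive_MSRD \<iota> m C \<longleftrightarrow>
     additive_code \<iota> C \<and> C \<noteq> {0} \<and>
     base_dim \<iota> C = m * CARD('r) * (CARD('l) * CARD('r) - d_SR C + 1)"

end

theory Submission
  imports Defs
begin

text \<open>
  The coefficients of \<open>\<phi>\<^sub>a\<close> lie in the field with \<open>q\<close> elements and sit in degrees divisible by \<open>r\<close>, so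
  \<open>\<phi>\<^sub>a\<close> is central and every twisted polynomial is an endomorphism. Since \<open>Q i \<noteq> T\<close>, the polynomial
  \<open>\<phi>\<^bsub>Q i\<^esub>(x)\<close> is separable, so the torsion has \<open>q\<^bsup>mr\<^esup>\<close> elements, i.e. dimension \<open>r\<close> over the residue field.
  If \<open>u \<noteq> 0\<close>, the kernels of \<open>u\<close> on the independent modules \<open>\<phi>[Q i]\<close> span a subgroup with
  \<open>q\<^bsup>m(lr - wt u)\<^esup>\<close> elements, all of them roots of a polynomial of degree \<open>q\<^bsup>deg u\<^esup>\<close> with
  \<open>deg u \<le> tm - 1\<close>; hence \<open>wt u \<ge> lr - t + 1\<close>. In particular evaluation is injective, which gives
  the dimension, and the Singleton bound gives the opposite inequality for the distance.
\<close>

section \<open>Finite fields\<close>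

text \<open>Multiplication by \<open>x \<noteq> 0\<close> permutes the nonzero elements, so it
  leaves their product unchanged. The extra factor \<open>x\<close> raises the exponent from
  \<open>CARD('a) - 1\<close> to \<open>CARD('a)\<close>.\<close>

lemma finite_field_power_card:
  fixes x :: "'a::{field,finite}"
  shows "x ^ CARD('a) = x"
proof (cases "x = 0")
  case False
  have "x * (\<Prod>y\<in>UNIV-{0}. x * y) = x * x ^ (CARD('a) - 1) * \<Prod>(UNIV-{0})"
    by (simp add: prod.distrib mult_ac)
  also have "x * x ^ (CARD('a) - 1) = x ^ Suc (CARD('a) - 1)"
    by (subst power_Suc) auto
  also have "Suc (CARD('a) - 1) = CARD('a)"
    using finite_UNIV_card_ge_0[where ?'a = 'a] by simp
  also have "(\<Prod>y\<in>UNIV-{0}. x * y) = (\<Prod>y\<in>UNIV-{0}. y)"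
    by (rule prod.reindex_bij_witness[of _ "\<lambda>y. y / x" "\<lambda>y. x * y"]) (use False in auto)
  finally show ?thesis
    by simp
qed (use finite_UNIV_card_ge_0[where ?'a = 'a] in auto)

lemma finite_field_power_card_power:
  fixes x :: "'a::{field,finite}"
  shows "x ^ (CARD('a) ^ n) = x"
  by (induction n) (simp_all add: finite_field_power_card power_mult)

lemma card_finite_field_ge_2: "CARD('a::{field,finite}) \<ge> 2"
proof -
  have "card {0, 1 :: 'a} \<le> CARD('a)"
    by (intro card_mono) auto
  thus ?thesis by simp
qed

text \<open>The polynomial \<open>(X + 1)\<^sup>q - X\<^sup>q - 1\<close> has degree less than \<open>q\<close> and vanishes on the field with
  \<open>q\<close> elements, hence is zero.\<close>

lemma of_nat_card_choose_eq_0: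
  assumes "0 < i" "i < CARD('f)"
  shows "of_nat (CARD('f) choose i) = (0 :: 'f::{field,finite})"
proof -
  define n where "n = CARD('f)"
  define P :: "'f poly" where
    "P = (\<Sum>j\<in>{0<..<n}. Polynomial.monom (of_nat (n choose j)) j)"
  have coeff_P: "Polynomial.coeff P j = (if j \<in> {0<..<n} then of_nat (n choose j) else 0)" for j
    by (simp add: P_def coeff_sum)
  have "P = 0"
  proof (rule ccontr)
    assume "P \<noteq> 0"
    have "poly P x = 0" for x
    proof -
      have "(x + 1) ^ n = (\<Sum>j\<le>n. of_nat (n choose j) * x ^ j)"
        by (subst binomial_ring) simp
      also have "{..n} = {0<..<n} \<union> {0, n}"
        using card_finite_field_ge_2[where ?'a='f] by (auto simp: n_def)
      also have "(\<Sum>j\<in>\<dots>. of_nat (n choose j) * x ^ j) = poly P x + 1 + x ^ n"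
        using card_finite_field_ge_2[where ?'a='f]
        by (subst sum.union_disjoint) (auto simp: n_def P_def poly_sum poly_monom)
      finally show ?thesis
        by (simp add: n_def finite_field_power_card)
    qed
    hence "card {x. poly P x = 0} = n"
      by (simp add: n_def)
    moreover have "card {x. poly P x = 0} \<le> Polynomial.degree P"
      by (rule card_poly_roots_bound) fact
    moreover have "Polynomial.degree P \<le> n - 1"
      by (intro degree_le) (auto simp: coeff_P)
    ultimately show False
      using card_finite_field_ge_2[where ?'a='f] by (simp add: n_def)
  qed
  thus ?thesis
    using coeff_P[of i] assms by (simp add: n_def)
qed

section \<open>Ring homomorphisms and additivity of Frobenius powers\<close>

lemma unital_ring_hom_1: "unital_ring_hom h \<Longrightarrow> h 1 = 1"
  and unital_ring_hom_add: "unital_ring_hom h \<Longrightarrow> h (x + y) = h x + h y"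
  and unital_ring_hom_mult: "unital_ring_hom h \<Longrightarrow> h (x * y) = h x * h y"
  by (auto simp: unital_ring_hom_def)

lemma unital_ring_hom_0: "unital_ring_hom h \<Longrightarrow> h 0 = 0"
  using unital_ring_hom_add[of h 0 0] by simp

lemma unital_ring_hom_diff: "unital_ring_hom h \<Longrightarrow> h (x - y) = h x - h y"
  using unital_ring_hom_add[of h "x - y" y] by (simp add: algebra_simps)

lemma unital_ring_hom_power: "unital_ring_hom h \<Longrightarrow> h (x ^ n) = h x ^ n"
  by (induction n) (auto simp: unital_ring_hom_1 unital_ring_hom_mult)

lemma unital_ring_hom_of_nat: "unital_ring_hom h \<Longrightarrow> h (of_nat n) = of_nat n"
  by (induction n) (auto simp: unital_ring_hom_0 unital_ring_hom_1 unital_ring_hom_add)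

lemma unital_ring_hom_field_eq_0_iff:
  fixes h :: "'a::field \<Rightarrow> 'b::comm_ring_1"
  assumes "unital_ring_hom h"
  shows "h x = 0 \<longleftrightarrow> x = 0"
proof (cases "x = 0")
  case False
  have "h x * h (inverse x) = 1"
    using unital_ring_hom_mult[OF assms, of x "inverse x"] unital_ring_hom_1[OF assms] False
    by simp
  thus ?thesis
    using False by auto
qed (simp add: unital_ring_hom_0[OF assms])

context
  fixes h :: "'f::{field,finite} \<Rightarrow> 'b::comm_ring_1"
  assumes h: "unital_ring_hom h"
begin

text \<open>The inner binomial coefficients already vanish in \<open>'f\<close>, and
  \<open>h\<close> carries this to \<open>'b\<close>; so it is enough that \<open>'b\<close>
  receives a homomorphism from \<open>'f\<close>.\<close>

lemma add_power_card: "(x + y :: 'b) ^ CARD('f) = x ^ CARD('f) + y ^ CARD('f)"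
proof -
  let ?n = "CARD('f)"
  have "(x + y) ^ ?n = (\<Sum>j\<le>?n. of_nat (?n choose j) * x ^ j * y ^ (?n - j))"
    by (rule binomial_ring)
  also have "\<dots> = (\<Sum>j\<in>{0, ?n}. of_nat (?n choose j) * x ^ j * y ^ (?n - j))"
  proof (rule sum.mono_neutral_right)
    show "\<forall>j\<in>{..?n} - {0, ?n}. of_nat (?n choose j) * x ^ j * y ^ (?n - j) = 0"
    proof
      fix j assume j: "j \<in> {..?n} - {0, ?n}"
      have "of_nat (?n choose j) = h (of_nat (?n choose j))"
        by (simp add: unital_ring_hom_of_nat h)
      also have "\<dots> = 0"
        using j by (subst of_nat_card_choose_eq_0) (auto simp: unital_ring_hom_0 h)
      finally show "of_nat (?n choose j) * x ^ j * y ^ (?n - j) = 0"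
        by simp
    qed
  qed auto
  finally show ?thesis
    using card_finite_field_ge_2[where ?'a='f] by (simp add: add.commute)
qed

lemma add_power_card_power:
  "(x + y :: 'b) ^ (CARD('f) ^ i) = x ^ (CARD('f) ^ i) + y ^ (CARD('f) ^ i)"
  by (induction i) (simp_all add: power_mult mult.commute[of "CARD('f)"] add_power_card)

lemma zero_power_card_power: "(0::'b) ^ (CARD('f) ^ i) = 0"
  using card_finite_field_ge_2[where ?'a='f] by (simp add: zero_power)

lemma sum_power_card_power:
  "(\<Sum>a\<in>A. g a :: 'b) ^ (CARD('f) ^ i) = (\<Sum>a\<in>A. g a ^ (CARD('f) ^ i))"
  by (induction A rule: infinite_finite_induct)
    (auto simp: add_power_card_power zero_power_card_power)

text \<open>The binomial coefficient \<open>CARD('f) choose 1\<close> gives the case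
  \<open>i = 1\<close>. Needed to differentiate powers with exponent \<open>q ^ i\<close>.\<close>

lemma of_nat_card_power_eq_0:
  assumes "i > 0"
  shows "of_nat (CARD('f) ^ i) = (0::'b)"
proof -
  have "of_nat (CARD('f) choose 1) = (0::'f)"
    using card_finite_field_ge_2[where ?'a='f] by (intro of_nat_card_choose_eq_0) auto
  hence "of_nat CARD('f) = h 0"
    by (metis unital_ring_hom_of_nat[OF h] choose_one)
  thus ?thesis
    using assms by (simp add: unital_ring_hom_0 h zero_power)
qed

end

text \<open>Coefficient sequences give the bijection. Positivity of \<open>n\<close> matters: zero
  has degree 0, so for \<open>n = 0\<close> the set is empty while the power is 1.\<close>

lemma card_poly_degree_less:
  assumes "n > 0"
  shows "card {p :: 'a::{comm_ring_1,finite} poly. Polynomial.degree p < n} = CARD('a) ^ n"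
    and "finite {p :: 'a poly. Polynomial.degree p < n}"
proof -
  have inj: "inj_on (\<lambda>p. \<lambda>i\<in>{..<n}. Polynomial.coeff p i) {p :: 'a poly. Polynomial.degree p < n}"
  proof (rule inj_onI)
    fix p p' :: "'a poly"
    assume deg: "p \<in> {p. Polynomial.degree p < n}" "p' \<in> {p. Polynomial.degree p < n}"
      and eq: "(\<lambda>i\<in>{..<n}. Polynomial.coeff p i) = (\<lambda>i\<in>{..<n}. Polynomial.coeff p' i)"
    show "p = p'"
    proof (rule poly_eqI)
      fix i
      show "Polynomial.coeff p i = Polynomial.coeff p' i"
        using deg fun_cong[OF eq, of i] by (cases "i < n") (auto simp: coeff_eq_0)
    qed
  qed
  have "(\<lambda>p. \<lambda>i\<in>{..<n}. Polynomial.coeff p i) ` {p :: 'a poly. Polynomial.degree p < n} =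
      {..<n} \<rightarrow>\<^sub>E UNIV"
  proof (intro equalityI subsetI)
    fix f :: "nat \<Rightarrow> 'a" assume f: "f \<in> {..<n} \<rightarrow>\<^sub>E UNIV"
    define p where "p = (\<Sum>i<n. Polynomial.monom (f i) i)"
    have coeff_p: "Polynomial.coeff p i = (if i < n then f i else 0)" for i
      by (simp add: p_def coeff_sum)
    have "Polynomial.degree p \<le> n - 1"
      by (intro degree_le) (auto simp: coeff_p)
    hence "Polynomial.degree p < n"
      using assms by simp
    moreover have "f = (\<lambda>i\<in>{..<n}. Polynomial.coeff p i)"
      using f by (auto simp: coeff_p fun_eq_iff PiE_iff extensional_def)
    ultimately show "f \<in> (\<lambda>p. \<lambda>i\<in>{..<n}. Polynomial.coeff p i) ` {p. Polynomial.degree p < n}"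
      by blast
  qed (auto split: if_splits)
  hence bij: "bij_betw (\<lambda>p. \<lambda>i\<in>{..<n}. Polynomial.coeff p i)
      {p :: 'a poly. Polynomial.degree p < n} ({..<n} \<rightarrow>\<^sub>E UNIV)"
    using inj by (simp add: bij_betw_def)
  show "card {p :: 'a poly. Polynomial.degree p < n} = CARD('a) ^ n"
    using bij_betw_same_card[OF bij] by (simp add: card_PiE)
  show "finite {p :: 'a poly. Polynomial.degree p < n}"
    using bij_betw_finite[OF bij] by (simp add: finite_PiE)
qed

section \<open>Counting over finite fields\<close>

text \<open>Each fibre is a coset of \<open>K\<close>. Assuming this directly avoids a group
  structure on the target of \<open>f\<close>.\<close>

lemma card_UNIV_fibres:
  fixes f :: "'a::{finite,ab_group_add} \<Rightarrow> 'b"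
  assumes "\<And>x y. f x = f y \<longleftrightarrow> x - y \<in> K"
  shows "CARD('a) = card K * card (range f)"
proof -
  have "CARD('a) = card (\<Union>z\<in>range f. f -` {z})"
    by (rule arg_cong[where f = card]) auto
  also have "\<dots> = (\<Sum>z\<in>range f. card (f -` {z}))"
    by (rule card_UN_disjoint) auto
  also have "\<dots> = (\<Sum>z\<in>range f. card K)"
  proof (rule sum.cong)
    fix z assume "z \<in> range f"
    then obtain x where z: "z = f x" by auto
    have "f -` {z} = (\<lambda>k. k + x) ` K"
    proof (intro equalityI subsetI)
      fix y assume "y \<in> f -` {z}"
      hence "y - x \<in> K" using assms z by auto
      thus "y \<in> (\<lambda>k. k + x) ` K" by (intro image_eqI[of _ _ "y - x"]) auto
    next
      fix y assume "y \<in> (\<lambda>k. k + x) ` K"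
      hence "y - x \<in> K" by auto
      thus "y \<in> f -` {z}" using assms z by auto
    qed
    thus "card (f -` {z}) = card K"
      by (simp add: card_image)
  qed simp
  finally show ?thesis by (simp add: mult.commute)
qed

text \<open>Rank-nullity as a count: pairing with a basis of the row space has the cosets of the
  kernel of \<open>A\<close> as fibres and takes at most \<open>CARD('e) ^ rank A\<close>
  values.\<close>

lemma card_matrix_kernel_ge:
  fixes A :: "'e::{field,finite} ^ 'n ^ 'm"
  shows "CARD('e) ^ CARD('n) \<le> card {v. A *v v = 0} * CARD('e) ^ rank A"
proof -
  obtain B where B: "B \<subseteq> rows A" "vec.independent B" "rows A \<subseteq> vec.span B" "card B = rank A"
    unfolding row_rank_def_gen by (rule vec.basis_exists)
  define f where "f = (\<lambda>v. \<lambda>b\<in>B. \<Sum>i\<in>UNIV. b $ i * (v $ i :: 'e))"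
  have ker: "(\<forall>b\<in>B. (\<Sum>i\<in>UNIV. b $ i * v $ i) = 0) \<longleftrightarrow> A *v v = 0" for v
  proof
    assume *: "\<forall>b\<in>B. (\<Sum>i\<in>UNIV. b $ i * v $ i) = 0"
    \<comment> \<open>The vectors orthogonal to \<open>v\<close> form a subspace, so vanishing on
      \<open>B\<close> extends to all rows.\<close>
    have sub: "vec.subspace {b. (\<Sum>i\<in>UNIV. b $ i * v $ i) = 0}"
      by (auto simp: vec.subspace_def distrib_right sum.distrib mult.assoc simp flip: sum_distrib_left)
    have "vec.span B \<subseteq> {b. (\<Sum>i\<in>UNIV. b $ i * v $ i) = 0}"
      using * by (intro vec.span_minimal sub) auto
    hence "(\<Sum>i\<in>UNIV. row j A $ i * v $ i) = 0" for j
      using B(3) by (auto simp: rows_def)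
    thus "A *v v = 0"
      by (simp add: vec_eq_iff matrix_vector_mult_def row_def)
  next
    assume *: "A *v v = 0"
    show "\<forall>b\<in>B. (\<Sum>i\<in>UNIV. b $ i * v $ i) = 0"
    proof
      fix b assume "b \<in> B"
      then obtain j where "b = row j A"
        using B(1) by (auto simp: rows_def)
      thus "(\<Sum>i\<in>UNIV. b $ i * v $ i) = 0"
        using * by (simp add: vec_eq_iff matrix_vector_mult_def row_def)
    qed
  qed
  have "f x = f y \<longleftrightarrow> x - y \<in> {v. A *v v = 0}" for x y
  proof -
    have "f x = f y \<longleftrightarrow> (\<forall>b\<in>B. (\<Sum>i\<in>UNIV. b $ i * (x - y) $ i) = 0)"
      by (auto simp: f_def fun_eq_iff restrict_def right_diff_distrib sum_subtractf)
    thus ?thesis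
      by (simp only: ker mem_Collect_eq)
  qed
  hence "CARD('e ^ 'n) = card {v. A *v v = 0} * card (range f)"
    by (rule card_UNIV_fibres)
  moreover have "card (range f) \<le> card (B \<rightarrow>\<^sub>E (UNIV :: 'e set))"
    by (intro card_mono finite_PiE) (auto simp: f_def)
  hence "card (range f) \<le> CARD('e) ^ rank A"
    by (simp add: card_PiE B(4))
  ultimately show ?thesis
    by simp
qed

text \<open>The nonzero rows alone span the row space. This bounds weights in the Singleton
  argument.\<close>

lemma rank_le_card_nonzero_rows:
  fixes A :: "'e::field ^ 'n ^ 'm"
  shows "rank A \<le> card {i. A $ i \<noteq> 0}"
proof -
  have "rows A \<subseteq> insert 0 ((\<lambda>i. A $ i) ` {i. A $ i \<noteq> 0})"
    by (auto simp: rows_def row_def)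
  also have "\<dots> \<subseteq> vec.span ((\<lambda>i. A $ i) ` {i. A $ i \<noteq> 0})"
    by (auto intro: vec.span_base vec.span_zero)
  finally have "vec.dim (rows A) \<le> card ((\<lambda>i. A $ i) ` {i. A $ i \<noteq> 0})"
    by (rule vec.dim_le_card) auto
  also have "\<dots> \<le> card {i. A $ i \<noteq> 0}"
    by (rule card_image_le) auto
  finally show ?thesis
    by (simp add: row_rank_def_gen)
qed

text \<open>Coordinates with respect to a basis identify \<open>S\<close> with the functions from
  the basis to \<open>'f\<close>; this later turns the size of the code into its dimension.\<close>

lemma card_finite_subspace:
  fixes scale :: "'f::{field,finite} \<Rightarrow> 'b::ab_group_add \<Rightarrow> 'b"
  assumes "vector_space scale" "module.subspace scale S" "finite S"
  shows "card S = CARD('f) ^ vector_space.dim scale S"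
proof -
  interpret vector_space scale by fact
  obtain B where B: "B \<subseteq> S" "independent B" "S \<subseteq> span B" "card B = dim S"
    by (rule basis_exists)
  have finB: "finite B"
    using B(1) assms(3) finite_subset by blast
  have "span B = S"
    using B(1,3) assms(2) span_minimal by blast
  have "inj_on (\<lambda>u. \<Sum>b\<in>B. scale (u b) b) (B \<rightarrow>\<^sub>E UNIV)"
  proof (rule inj_onI)
    fix u u' assume u: "u \<in> B \<rightarrow>\<^sub>E UNIV" "u' \<in> B \<rightarrow>\<^sub>E UNIV"
      and eq: "(\<Sum>b\<in>B. scale (u b) b) = (\<Sum>b\<in>B. scale (u' b) b)"
    have "(\<Sum>b\<in>B. scale (u b - u' b) b) = 0"
      using eq by (simp add: scale_left_diff_distrib sum_subtractf)
    hence "u b - u' b = 0" if "b \<in> B" for b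
      using independentD[OF B(2) finB order.refl _ that, of "\<lambda>b. u b - u' b"] by simp
    thus "u = u'"
      using u by (intro PiE_ext[of u B _ u']) auto
  qed
  moreover have "(\<lambda>u. \<Sum>b\<in>B. scale (u b) b) ` (B \<rightarrow>\<^sub>E UNIV) = span B"
  proof -
    have "(\<Sum>b\<in>B. scale (u b) b) \<in> (\<lambda>u. \<Sum>b\<in>B. scale (u b) b) ` (B \<rightarrow>\<^sub>E UNIV)" for u
      by (intro image_eqI[of _ _ "restrict u B"]) auto
    thus ?thesis
      unfolding span_finite[OF finB] by auto
  qed
  ultimately have "card (span B) = card (B \<rightarrow>\<^sub>E (UNIV :: 'f set))"
    using card_image by fastforce
  thus ?thesis
    using B(4) \<open>span B = S\<close> by (simp add: card_PiE finB)
qed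

section \<open>Residues modulo an irreducible polynomial\<close>

text \<open>The cofactor is a unit, hence constant, and comparing leading coefficients makes it 1.
  Applied to two of the \<open>Q i\<close>, and to \<open>T\<close> and \<open>Q i\<close>.\<close>

lemma irreducible_monic_dvd_imp_eq:
  fixes p p' :: "'f::field poly"
  assumes "Factorial_Ring.irreducible p'" "p dvd p'" "lead_coeff p = 1" "lead_coeff p' = 1"
    "Polynomial.degree p > 0"
  shows "p = p'"
proof -
  obtain k where k: "p' = p * k" using assms(2) by (rule dvdE)
  hence "p dvd 1 \<or> k dvd 1"
    using assms(1) by (auto simp: Factorial_Ring.irreducible_def)
  moreover have "\<not> p dvd 1"
    using assms(3,5) by (metis is_unit_iff_degree less_irrefl zero_neq_one coeff_0)
  ultimately obtain c where c: "k = [:c:]"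
    by (auto simp: is_unit_poly_iff)
  have "c \<noteq> 0"
    using assms(4) by (auto simp: k c)
  hence "c = 1"
    using assms(3,4) by (simp add: k c lead_coeff_mult)
  thus ?thesis by (simp add: k c)
qed

lemma prime_elem_dvd_prod_finite:
  assumes "finite A" "prime_elem p" "p dvd prod f A"
  shows "\<exists>x\<in>A. p dvd f x"
  using assms(1,3)
proof (induction A rule: finite_induct)
  case empty
  thus ?case using assms(2) by (auto simp: prime_elem_def)
next
  case (insert x A)
  thus ?case using prime_elem_dvd_multD[OF assms(2)] by fastforce
qed

context
  fixes p :: "'f::{field,finite} poly"
  assumes irred: "Factorial_Ring.irreducible p"
begin

lemma irreducible_poly_degree_pos: "Polynomial.degree p > 0"
  using irred by (metis Factorial_Ring.irreducible_def is_unit_iff_degree gr0I)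

lemma irreducible_poly_prime_elem: "prime_elem p"
  by (rule field_poly_irreducible_imp_prime[OF irred])

lemma irreducible_poly_degree_mod: "Polynomial.degree (a mod p) < Polynomial.degree p"
  using irreducible_poly_degree_pos degree_mod_less[of p a] by (cases "a mod p = 0"; cases "p = 0") auto

text \<open>Polynomials of degree below that of \<open>p\<close> serve as representatives of the
  residue field; a difference of two of them has too small a degree to be a nonzero multiple of
  \<open>p\<close>.\<close>

lemma residue_eqI:
  assumes "Polynomial.degree a < Polynomial.degree p" "Polynomial.degree b < Polynomial.degree p"
    "p dvd a - b"
  shows "a = b"
proof (rule ccontr)
  assume "a \<noteq> b"
  hence "Polynomial.degree p \<le> Polynomial.degree (a - b)"
    using assms(3) by (intro dvd_imp_degree_le) auto
  thus False
    using degree_diff_less[OF assms(1,2)] by simp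
qed

text \<open>Since \<open>p\<close> is prime, \<open>a\<close> can be cancelled modulo
  \<open>p\<close>; on the finite set of representatives injectivity gives surjectivity.\<close>

lemma residue_mult_bij:
  assumes "\<not> p dvd a"
  shows "bij_betw (\<lambda>b. a * b mod p) {b. Polynomial.degree b < Polynomial.degree p}
      {b. Polynomial.degree b < Polynomial.degree p}"
proof -
  have "inj_on (\<lambda>b. a * b mod p) {b. Polynomial.degree b < Polynomial.degree p}"
  proof (rule inj_onI)
    fix b b' assume b: "b \<in> {b. Polynomial.degree b < Polynomial.degree p}"
        "b' \<in> {b. Polynomial.degree b < Polynomial.degree p}"
      and "a * b mod p = a * b' mod p"
    hence "p dvd a * (b - b')"
      by (simp add: mod_eq_dvd_iff right_diff_distrib)
    hence "p dvd b - b'"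
      using assms prime_elem_dvd_multD[OF irreducible_poly_prime_elem] by blast
    thus "b = b'"
      using b by (intro residue_eqI) auto
  qed
  moreover have "(\<lambda>b. a * b mod p) ` {b. Polynomial.degree b < Polynomial.degree p} \<subseteq>
      {b. Polynomial.degree b < Polynomial.degree p}"
    by (auto intro: irreducible_poly_degree_mod)
  ultimately show ?thesis
    using endo_inj_surj[OF card_poly_degree_less(2)[OF irreducible_poly_degree_pos]]
    by (simp add: bij_betw_def)
qed

lemma residue_inverse:
  assumes "\<not> p dvd a"
  obtains c where "p dvd a * c - 1"
proof -
  have "1 \<in> (\<lambda>b. a * b mod p) ` {b. Polynomial.degree b < Polynomial.degree p}"
    using residue_mult_bij[OF assms] irreducible_poly_degree_pos by (simp add: bij_betw_def)
  then obtain c where "1 = a * c mod p" by auto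
  hence "a * c mod p = 1 mod p" by (metis mod_mod_trivial)
  thus thesis using that by (simp add: mod_eq_dvd_iff)
qed

text \<open>Fermat's theorem in the residue field, by the argument of
  \<open>finite_field_power_card\<close>: multiplication by \<open>a\<close> permutes the nonzero
  representatives, whose product is prime to \<open>p\<close>.\<close>

lemma residue_power_card: "p dvd a ^ (CARD('f) ^ Polynomial.degree p) - a"
proof (cases "p dvd a")
  case True
  thus ?thesis by (auto intro!: dvd_diff dvd_trans[OF True] simp: dvd_power)
next
  case False
  define R where "R = {b :: 'f poly. Polynomial.degree b < Polynomial.degree p} - {0}"
  define N where "N = CARD('f) ^ Polynomial.degree p"
  have N: "card R = N - 1" "finite R" "N > 0"
    using card_poly_degree_less[OF irreducible_poly_degree_pos, where ?'a = 'f]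
      irreducible_poly_degree_pos by (auto simp: R_def N_def)
  have nd: "\<not> p dvd b" if "b \<in> R" for b
    using that residue_eqI[of b 0] irreducible_poly_degree_pos by (auto simp: R_def)
  have "bij_betw (\<lambda>b. a * b mod p) R R"
    unfolding R_def using residue_mult_bij[OF False]
    by (rule bij_betw_DiffI) (auto simp: irreducible_poly_degree_pos)
  hence "(\<Prod>b\<in>R. a * b mod p) = \<Prod>R"
    by (rule prod.reindex_bij_betw[where g = "\<lambda>x. x"])
  hence "(\<Prod>b\<in>R. a * b mod p) mod p = \<Prod>R mod p"
    by simp
  hence "(\<Prod>b\<in>R. a * b) mod p = \<Prod>R mod p"
    by (simp add: mod_prod_eq)
  hence "p dvd (a ^ (N - 1) - 1) * \<Prod>R"
    by (simp add: mod_eq_dvd_iff prod.distrib N left_diff_distrib)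
  moreover have "\<not> p dvd \<Prod>R"
    using prime_elem_dvd_prod_finite[OF N(2) irreducible_poly_prime_elem, of "\<lambda>x. x"] nd by blast
  ultimately have "p dvd a ^ (N - 1) - 1"
    using prime_elem_dvd_multD[OF irreducible_poly_prime_elem] by blast
  hence "p dvd a * (a ^ (N - 1) - 1)" by simp
  also have "\<dots> = a ^ N - a"
    using N(3) by (simp add: right_diff_distrib power_eq_if)
  finally show ?thesis by (simp add: N_def)
qed

end

text \<open>A root \<open>\<theta>\<close> of \<open>p\<close> in \<open>'e\<close> exists because
  \<open>p\<close> divides \<open>X ^ N - X\<close>, which vanishes on all \<open>N\<close> elements
  of \<open>'e\<close>, while the cofactor \<open>s\<close> has fewer than \<open>N\<close> roots.
  Evaluation at \<open>\<theta>\<close> is the required map.\<close>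

lemma residue_iso_exists:
  fixes \<iota> :: "'f::{field,finite} \<Rightarrow> 'e::{field,finite}"
  assumes \<iota>: "unital_ring_hom \<iota>" and irred: "Factorial_Ring.irreducible p"
    and card: "CARD('e) = CARD('f) ^ Polynomial.degree p"
  shows "\<exists>\<sigma>. residue_iso \<iota> p \<sigma>"
proof -
  define ev where "ev = (\<lambda>\<theta> a. poly (map_poly \<iota> a) \<theta>)"
  note \<iota>0 = unital_ring_hom_0[OF \<iota>]
  have ev_0: "ev \<theta> 0 = 0" for \<theta>
    by (simp add: ev_def)
  have ev_pCons: "ev \<theta> (pCons c a) = \<iota> c + \<theta> * ev \<theta> a" for \<theta> c a
    by (simp add: ev_def map_poly_pCons \<iota>0)
  have ev_add: "ev \<theta> (a + b) = ev \<theta> a + ev \<theta> b" for \<theta> a b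
    by (induction a b rule: poly_induct2)
      (auto simp: ev_0 ev_pCons unital_ring_hom_add[OF \<iota>] algebra_simps)
  have ev_smult: "ev \<theta> (smult c a) = \<iota> c * ev \<theta> a" for \<theta> c a
    by (induction a) (auto simp: ev_0 ev_pCons unital_ring_hom_mult[OF \<iota>] algebra_simps)
  have ev_mult: "ev \<theta> (a * b) = ev \<theta> a * ev \<theta> b" for \<theta> a b
    by (induction a) (auto simp: ev_0 ev_pCons ev_add ev_smult \<iota>0 algebra_simps)
  have hom: "unital_ring_hom (ev \<theta>)" for \<theta>
    unfolding unital_ring_hom_def
    by (auto simp: ev_add ev_mult one_pCons ev_pCons ev_0 unital_ring_hom_1[OF \<iota>])

  define N where "N = CARD('e)"
  obtain s where s: "[:0, 1:] ^ N - [:0, 1:] = p * s"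
    using residue_power_card[OF irred, of "[:0, 1:]"] by (auto simp: N_def card elim: dvdE)
  have N: "N \<ge> 2"
    using card_finite_field_ge_2[where ?'a='e] by (simp add: N_def)
  have deg: "Polynomial.degree ([:0, 1 :: 'f:] ^ N - [:0, 1:]) = N"
    using N degree_add_eq_left[of "- [:0, 1 :: 'f:]" "[:0, 1:] ^ N"] by (simp add: degree_linear_power del: minus_pCons)
  hence "p * s \<noteq> 0"
    using N by (auto simp flip: s)
  hence degs: "Polynomial.degree p + Polynomial.degree s = N" "s \<noteq> 0"
    using deg unfolding s by (auto simp: degree_mult_eq)
  obtain \<theta> where \<theta>: "ev \<theta> p = 0"
  proof (rule ccontr)
    assume "\<not> thesis"
    hence nz: "ev \<theta> p \<noteq> 0" for \<theta>
      using that by blast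
    have "ev \<theta> s = 0" for \<theta>
    proof -
      have "ev \<theta> p * ev \<theta> s = \<theta> ^ N - \<theta>"
        unfolding ev_mult[symmetric] s[symmetric]
        by (simp add: unital_ring_hom_diff[OF hom] unital_ring_hom_power[OF hom] ev_pCons ev_0 \<iota>0
            unital_ring_hom_1[OF \<iota>])
      thus ?thesis
        using nz[of \<theta>] by (simp add: N_def finite_field_power_card)
    qed
    hence "card {\<theta>. poly (map_poly \<iota> s) \<theta> = 0} = N"
      by (simp add: ev_def N_def)
    moreover have "card {\<theta>. poly (map_poly \<iota> s) \<theta> = 0} \<le> Polynomial.degree (map_poly \<iota> s)"
      using degs(2) by (intro card_poly_roots_bound)
        (simp add: map_poly_eq_0_iff \<iota>0 unital_ring_hom_field_eq_0_iff[OF \<iota>])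
    moreover have "Polynomial.degree (map_poly \<iota> s) = Polynomial.degree s"
      by (intro degree_map_poly) (simp add: unital_ring_hom_field_eq_0_iff[OF \<iota>])
    ultimately show False
      using degs irreducible_poly_degree_pos[OF irred] by simp
  qed
  have ker: "ev \<theta> a = 0 \<longleftrightarrow> p dvd a" for a
  proof
    assume a: "ev \<theta> a = 0"
    show "p dvd a"
    proof (rule ccontr)
      \<comment> \<open>Otherwise \<open>a\<close> would be invertible modulo \<open>p\<close>, and
        evaluation would send 1 to 0.\<close>
      assume "\<not> p dvd a"
      then obtain c where "p dvd a * c - 1"
        by (rule residue_inverse[OF irred])
      hence "ev \<theta> (a * c - 1) = 0"
        using \<theta> by (auto simp: ev_mult elim!: dvdE)
      thus False
        using a by (simp add: unital_ring_hom_diff[OF hom] ev_mult unital_ring_hom_1[OF hom])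
    qed
  qed (use \<theta> in \<open>auto simp: ev_mult elim!: dvdE\<close>)
  \<comment> \<open>Injectivity on representatives suffices for surjectivity, since there are
    exactly \<open>CARD('e)\<close> of them.\<close>
  have "inj_on (ev \<theta>) {a. Polynomial.degree a < Polynomial.degree p}"
    by (intro inj_onI residue_eqI[OF irred])
      (auto simp: unital_ring_hom_diff[OF hom] simp flip: ker)
  hence "card (ev \<theta> ` {a. Polynomial.degree a < Polynomial.degree p}) = CARD('e)"
    using card_poly_degree_less(1)[OF irreducible_poly_degree_pos[OF irred], where ?'a='f]
    by (simp add: card_image card)
  hence "ev \<theta> ` {a. Polynomial.degree a < Polynomial.degree p} = UNIV"
    by (intro card_subset_eq) auto
  hence "surj (ev \<theta>)"
    by blast
  hence "residue_iso \<iota> p (ev \<theta>)"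
    unfolding residue_iso_def by (auto simp: hom ker ev_pCons ev_0)
  thus ?thesis by blast
qed

section \<open>Torsion in modules over a polynomial ring\<close>

text \<open>An arbitrary module over the polynomial ring; the instance used later is
  \<open>'k alg_closure\<close> with scalar multiplication \<open>act\<close>.\<close>

locale finite_field_poly_module = Modules.module scale
  for scale :: "'f::{field,finite} poly \<Rightarrow> 'g::ab_group_add \<Rightarrow> 'g" (infixr \<open>\<star>\<close> 75)
begin

lemma scale_dvd_eq_0: "p \<star> x = 0 \<Longrightarrow> p dvd a \<Longrightarrow> a \<star> x = 0"
  by (auto elim!: dvdE) (metis scale_scale scale_zero_right mult.commute)

lemma scale_cong_dvd: "p \<star> x = 0 \<Longrightarrow> p dvd a - b \<Longrightarrow> a \<star> x = b \<star> x"
  using scale_dvd_eq_0[of p x "a - b"] by (simp add: scale_left_diff_distrib)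

text \<open>Each \<open>P j\<close> is invertible modulo \<open>p\<close>, hence acts injectively on
  \<open>p\<close>-torsion, so the factors can be stripped off one at a time.\<close>

lemma torsion_prod_eq_0:
  assumes "finite J" "\<And>j. j \<in> J \<Longrightarrow> \<exists>c. p dvd P j * c - 1"
    and "p \<star> x = 0" "(\<Prod>j\<in>J. P j) \<star> x = 0"
  shows "x = 0"
  using assms
proof (induction J rule: finite_induct)
  case (insert j J)
  define z where "z = (\<Prod>j\<in>J. P j) \<star> x"
  obtain c where c: "p dvd P j * c - 1"
    using insert.prems(1) by blast
  have z: "p \<star> z = 0"
    using insert.prems(2) unfolding z_def by (metis scale_scale scale_zero_right mult.commute)
  have "z = 1 \<star> z" by simp
  also have "\<dots> = (P j * c) \<star> z"
    using scale_cong_dvd[OF z c] by simp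
  also have "\<dots> = c \<star> (P j * (\<Prod>j\<in>J. P j)) \<star> x"
    by (simp add: z_def mult_ac)
  also have "\<dots> = 0"
    using insert by simp
  finally show ?case
    using insert by (auto simp: z_def)
qed auto

text \<open>Multiplying the relation by the product of the \<open>P j\<close> with
  \<open>j \<noteq> i\<close> kills every summand except \<open>x i\<close>. Thus the torsion
  submodules of pairwise coprime elements are independent.\<close>

lemma torsion_sum_eq_0:
  assumes "finite I" "\<And>i j. i \<in> I \<Longrightarrow> j \<in> I \<Longrightarrow> i \<noteq> j \<Longrightarrow> \<exists>c. P i dvd P j * c - 1"
    and x: "\<And>i. i \<in> I \<Longrightarrow> P i \<star> x i = 0" and "(\<Sum>i\<in>I. x i) = 0" "i \<in> I"
  shows "x i = 0"
proof (rule torsion_prod_eq_0[of "I - {i}" "P i" P])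
  show "(\<Prod>j\<in>I-{i}. P j) \<star> x i = 0"
  proof -
    have "0 = (\<Prod>j\<in>I-{i}. P j) \<star> (\<Sum>j\<in>I. x j)"
      using assms(4) by simp
    also have "\<dots> = (\<Prod>j\<in>I-{i}. P j) \<star> x i + (\<Sum>k\<in>I-{i}. (\<Prod>j\<in>I-{i}. P j) \<star> x k)"
      using sum.remove[OF assms(1,5), of x] by (simp add: scale_sum_right scale_right_distrib)
    also have "(\<Sum>k\<in>I-{i}. (\<Prod>j\<in>I-{i}. P j) \<star> x k) = 0"
      using assms(1) by (intro sum.neutral ballI scale_dvd_eq_0[OF x] dvd_prodI) auto
    finally show ?thesis by simp
  qed
qed (use assms in auto)

text \<open>Independent elements are chosen one at a time: fewer than \<open>CARD('r)\<close> of
  them span too few elements to fill the torsion. Once there are \<open>CARD('r)\<close>, the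
  assumption \<open>card\<close> forces them to span.\<close>

lemma torsion_basis_exists:
  fixes p :: "'f poly"
  assumes irred: "Factorial_Ring.irreducible p"
    and card: "card {x. p \<star> x = 0} = (CARD('f) ^ Polynomial.degree p) ^ CARD('r::finite)"
  shows "\<exists>\<beta> :: 'r \<Rightarrow> 'g. range \<beta> \<subseteq> {x. p \<star> x = 0} \<and>
     (\<forall>\<alpha>\<in>{x. p \<star> x = 0}. \<exists>a. \<alpha> = (\<Sum>x\<in>UNIV. a x \<star> \<beta> x)) \<and>
     (\<forall>a. (\<Sum>x\<in>UNIV. a x \<star> \<beta> x) = 0 \<longrightarrow> (\<forall>x. p dvd a x))"
proof -
  define R where "R = {b :: 'f poly. Polynomial.degree b < Polynomial.degree p}"
  have R: "card R = CARD('f) ^ Polynomial.degree p" "finite R"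
    using card_poly_degree_less[OF irreducible_poly_degree_pos[OF irred], where ?'a = 'f]
    by (auto simp: R_def)
  have fin: "finite {x. p \<star> x = 0}"
    using card by (intro card_ge_0_finite) auto
  have modR: "a mod p \<in> R" for a
    by (simp add: R_def irreducible_poly_degree_mod[OF irred])
  have "\<exists>\<beta>. (\<forall>x\<in>S. p \<star> \<beta> x = 0) \<and> (\<forall>a. (\<Sum>x\<in>S. a x \<star> \<beta> x) = 0 \<longrightarrow> (\<forall>x\<in>S. p dvd a x))"
    for S :: "'r set"
  proof (induction S rule: finite_induct[OF finite])
    case (2 y S)
    hence notin: "y \<notin> S" by blast
    from 2 obtain \<beta> where \<beta>: "\<forall>x\<in>S. p \<star> \<beta> x = 0"
      "\<And>a. (\<Sum>x\<in>S. a x \<star> \<beta> x) = 0 \<Longrightarrow> (\<forall>x\<in>S. p dvd a x)" by blast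
    \<comment> \<open>The span of the partial family: coefficients reduced modulo \<open>p\<close>
      suffice, as \<open>comb\<close> shows.\<close>
    define V where "V = (\<lambda>a. \<Sum>x\<in>S. a x \<star> \<beta> x) ` (S \<rightarrow>\<^sub>E R)"
    have "card V \<le> card (S \<rightarrow>\<^sub>E R)"
      unfolding V_def by (intro card_image_le finite_PiE) (auto simp: R)
    also have "\<dots> = card R ^ card S"
      by (simp add: card_PiE)
    also have "\<dots> < card R ^ CARD('r)"
    proof (rule power_strict_increasing)
      show "card S < CARD('r)"
        using notin by (intro psubset_card_mono) auto
      show "card R > 1"
        using card_finite_field_ge_2[where ?'a = 'f] irreducible_poly_degree_pos[OF irred]
        by (subst R) (intro one_less_power, auto)
    qed
    finally have "card V < card {x. p \<star> x = 0}"
      by (simp add: card R)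
    hence "\<not> {x. p \<star> x = 0} \<subseteq> V"
      using card_mono[of V "{x. p \<star> x = 0}"] finite_imageI[OF finite_PiE[of S "\<lambda>_. R"]] R(2)
      unfolding V_def by fastforce
    then obtain \<alpha> where \<alpha>: "p \<star> \<alpha> = 0" "\<alpha> \<notin> V" by auto
    have comb: "(\<Sum>x\<in>S. a x \<star> \<beta> x) \<in> V" for a
    proof -
      have "(\<Sum>x\<in>S. a x \<star> \<beta> x) = (\<Sum>x\<in>S. restrict (\<lambda>x. a x mod p) S x \<star> \<beta> x)"
        using \<beta>(1) by (intro sum.cong) (auto intro!: scale_cong_dvd[of p] simp flip: mod_eq_dvd_iff)
      thus ?thesis
        unfolding V_def using modR by (intro image_eqI[where x = "\<lambda>x\<in>S. a x mod p"]) auto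
    qed
    define \<beta>' where "\<beta>' = (\<lambda>x. if x = y then \<alpha> else \<beta> x)"
    have "\<forall>x\<in>insert y S. p dvd a x" if "(\<Sum>x\<in>insert y S. a x \<star> \<beta>' x) = 0" for a
    proof -
      have "(\<Sum>x\<in>S. a x \<star> \<beta>' x) = (\<Sum>x\<in>S. a x \<star> \<beta> x)"
        using notin by (intro sum.cong) (auto simp: \<beta>'_def)
      hence eq: "a y \<star> \<alpha> + (\<Sum>x\<in>S. a x \<star> \<beta> x) = 0"
        using that notin by (simp add: \<beta>'_def)
      have "p dvd a y"
      proof (rule ccontr)
        \<comment> \<open>An inverse of \<open>a y\<close> modulo \<open>p\<close> would express
          \<open>\<alpha>\<close> through the old elements, against its choice outside
          \<open>V\<close>.\<close>
        assume "\<not> p dvd a y"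
        then obtain c where c: "p dvd a y * c - 1"
          by (rule residue_inverse[OF irred])
        have "\<alpha> = c \<star> a y \<star> \<alpha>"
          using scale_cong_dvd[OF \<alpha>(1) c] by (simp add: mult.commute)
        also have "a y \<star> \<alpha> = - (\<Sum>x\<in>S. a x \<star> \<beta> x)"
          using eq by (simp add: eq_neg_iff_add_eq_0)
        also have "c \<star> \<dots> = (\<Sum>x\<in>S. (- c * a x) \<star> \<beta> x)"
          by (simp add: scale_sum_right sum_negf)
        finally show False
          using \<alpha>(2) comb by metis
      qed
      thus ?thesis
        using eq \<beta>(2)[of a] scale_dvd_eq_0[OF \<alpha>(1)] by simp
    qed
    moreover have "\<forall>x\<in>insert y S. p \<star> \<beta>' x = 0"
      using \<alpha>(1) \<beta>(1) by (simp add: \<beta>'_def)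
    ultimately show ?case
      by blast
  qed simp
  from this[of UNIV] obtain \<beta> :: "'r \<Rightarrow> 'g" where \<beta>: "\<And>x. p \<star> \<beta> x = 0"
    "\<And>a. (\<Sum>x\<in>UNIV. a x \<star> \<beta> x) = 0 \<Longrightarrow> (\<forall>x. p dvd a x)" by auto
  define F where "F = (\<lambda>a. \<Sum>x\<in>UNIV. a x \<star> \<beta> x)"
  have "inj_on F (UNIV \<rightarrow>\<^sub>E R)"
  proof (intro inj_onI ext)
    fix a b x assume ab: "a \<in> UNIV \<rightarrow>\<^sub>E R" "b \<in> UNIV \<rightarrow>\<^sub>E R" and "F a = F b"
    hence "(\<Sum>x\<in>UNIV. (a x - b x) \<star> \<beta> x) = 0"
      by (simp add: F_def scale_left_diff_distrib sum_subtractf)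
    hence "p dvd a x - b x"
      using \<beta>(2)[of "\<lambda>x. a x - b x"] by simp
    moreover have "a x \<in> R" "b x \<in> R"
      using ab by auto
    ultimately show "a x = b x"
      by (intro residue_eqI[OF irred]) (auto simp: R_def)
  qed
  hence "card (F ` (UNIV \<rightarrow>\<^sub>E R)) = card {x. p \<star> x = 0}"
    by (simp add: card_image card_PiE card R)
  moreover have "F ` (UNIV \<rightarrow>\<^sub>E R) \<subseteq> {x. p \<star> x = 0}"
  proof -
    have "p \<star> F a = 0" for a
      using \<beta>(1) unfolding F_def scale_sum_right
      by (intro sum.neutral) (metis scale_scale scale_zero_right mult.commute)
    thus ?thesis by auto
  qed
  ultimately have "F ` (UNIV \<rightarrow>\<^sub>E R) = {x. p \<star> x = 0}"
    using fin by (intro card_subset_eq) auto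
  hence "\<forall>\<alpha>\<in>{x. p \<star> x = 0}. \<exists>a. \<alpha> = (\<Sum>x\<in>UNIV. a x \<star> \<beta> x)"
    unfolding F_def by blast
  thus ?thesis
    using \<beta> by blast
qed

end

section \<open>Twisted polynomials\<close>

text \<open>Over an algebraically closed field the roots counted with multiplicity number the
  degree; a multiple root would also be a root of the derivative.\<close>

lemma card_roots_eq_degree:
  fixes P :: "'a::alg_closed_field poly"
  assumes "P \<noteq> 0" "\<And>a. poly P a = 0 \<Longrightarrow> poly (pderiv P) a \<noteq> 0"
  shows "card {x. poly P x = 0} = Polynomial.degree P"
proof -
  obtain A where A: "size A = Polynomial.degree P"
      "P = smult (lead_coeff P) (\<Prod>x\<in>#A. [:-x, 1:])"
    using alg_closed_imp_factorization[OF assms(1)] by blast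
  have "proots (\<Prod>x\<in>#A. [:-x, 1:]) = A"
  proof (induction A)
    case (add a A)
    have "(\<Prod>x\<in>#A. [:-x, 1:]) \<noteq> 0"
      by (auto simp: prod_mset_zero_iff)
    hence "proots ([:-a, 1:] * (\<Prod>x\<in>#A. [:-x, 1:])) = add_mset a A"
      by (subst proots_mult) (simp_all add: add)
    thus ?case by simp
  qed simp
  hence proots: "proots P = A"
    using assms(1) by (subst A(2)) simp
  have "order a P \<le> 1" for a
  proof (rule ccontr)
    assume "\<not> order a P \<le> 1"
    hence "[:-a, 1:] ^ 2 dvd P"
      using order_1[of a P] le_imp_power_dvd[of 2 "order a P" "[:-a, 1:]"] dvd_trans by force
    then obtain R where R: "P = [:-a, 1:] * ([:-a, 1:] * R)"
      unfolding power2_eq_square by (metis dvdE mult.assoc)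
    have "poly P a = 0" "poly (pderiv P) a = 0"
      by (simp_all add: R pderiv_mult del: mult_pCons_left)
    thus False
      using assms(2) by blast
  qed
  hence "count A a = 1" if "a \<in># A" for a
    using that assms(1) unfolding proots[symmetric]
    by (metis count_greater_zero_iff count_proots le_antisym One_nat_def Suc_leI)
  hence "size A = card (set_mset A)"
    by (simp add: size_multiset_overloaded_eq)
  thus ?thesis
    using A(1) assms(1) by (simp flip: proots)
qed

text \<open>Positivity of \<open>q\<close> ensures \<open>0 ^ (q ^ i) = 0\<close>, so terms beyond
  the degree of \<open>v\<close> vanish and the double sum becomes a convolution.\<close>

lemma coeff_tw_mult:
  assumes "q > 0"
  shows "Polynomial.coeff (tw_mult q u v) n =
    (\<Sum>i\<le>n. Polynomial.coeff u i * Polynomial.coeff v (n - i) ^ (q ^ i))"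
proof -
  define g where "g = (\<lambda>i. Polynomial.coeff u i * Polynomial.coeff v (n - i) ^ (q ^ i))"
  have "Polynomial.coeff (tw_mult q u v) n = (\<Sum>i\<le>Polynomial.degree u. if i \<le> n then g i else 0)"
    unfolding tw_mult_def coeff_sum
  proof (rule sum.cong)
    fix i
    have "(\<Sum>j\<le>Polynomial.degree v. Polynomial.coeff (Polynomial.monom
            (Polynomial.coeff u i * Polynomial.coeff v j ^ q ^ i) (i + j)) n) =
          (\<Sum>j\<le>Polynomial.degree v. if j = n - i then (if i \<le> n then g i else 0) else 0)"
      by (rule sum.cong) (auto simp: g_def)
    also have "\<dots> = (if i \<le> n then g i else 0)"
      using assms by (auto simp: g_def coeff_eq_0 zero_power)
    finally show "(\<Sum>j\<le>Polynomial.degree v. Polynomial.coeff (Polynomial.monom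
        (Polynomial.coeff u i * Polynomial.coeff v j ^ q ^ i) (i + j)) n) =
        (if i \<le> n then g i else 0)" .
  qed simp
  also have "\<dots> = (\<Sum>i\<in>{..Polynomial.degree u} \<inter> {..n}. g i)"
    by (simp add: sum.If_cases atMost_def Int_def)
  also have "\<dots> = (\<Sum>i\<le>n. g i)"
    by (rule sum.mono_neutral_left) (auto simp: g_def coeff_eq_0)
  finally show ?thesis by (simp add: g_def)
qed

lemma tw_act_altdef:
  assumes "Polynomial.degree u \<le> n"
  shows "tw_act q u x = (\<Sum>i\<le>n. to_ac (Polynomial.coeff u i) * x ^ (q ^ i))"
  unfolding tw_act_def using assms by (intro sum.mono_neutral_left) (auto simp: coeff_eq_0)

lemma tw_act_zero_left [simp]: "tw_act q 0 x = 0"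
  by (simp add: tw_act_def)

lemma tw_act_add_left: "tw_act q (u + v) x = tw_act q u x + tw_act q v x"
proof -
  define n where "n = max (Polynomial.degree u) (Polynomial.degree v)"
  have "Polynomial.degree (u + v) \<le> n"
    by (simp add: n_def degree_add_le_max)
  thus ?thesis
    by (simp add: tw_act_altdef[of _ n] n_def distrib_right sum.distrib)
qed

lemma tw_act_smult: "tw_act q (smult c u) x = to_ac c * tw_act q u x"
  by (simp add: tw_act_altdef[of _ "Polynomial.degree u"] sum_distrib_left mult.assoc)

lemma tw_act_sum_left: "tw_act q (\<Sum>i\<in>I. f i) x = (\<Sum>i\<in>I. tw_act q (f i) x)"
  by (induction I rule: infinite_finite_induct) (auto simp: tw_act_add_left)

lemma tw_act_monom: "tw_act q (Polynomial.monom c n) x = to_ac c * x ^ (q ^ n)"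
proof -
  have "tw_act q (Polynomial.monom c n) x =
      (\<Sum>i\<le>n. to_ac (Polynomial.coeff (Polynomial.monom c n) i) * x ^ q ^ i)"
    by (rule tw_act_altdef) (rule degree_monom_le)
  also have "\<dots> = (\<Sum>i\<le>n. if i = n then to_ac c * x ^ q ^ n else 0)"
    by (rule sum.cong) auto
  finally show ?thesis by simp
qed

text \<open>The linearized polynomial of \<open>u\<close>: an ordinary polynomial with the values of
  \<open>tw_act\<close>, so that root counts apply to the kernel of \<open>u\<close>.\<close>

definition tw_act_poly :: "nat \<Rightarrow> 'k::field poly \<Rightarrow> 'k alg_closure poly" where
  "tw_act_poly q u = (\<Sum>i\<le>Polynomial.degree u. Polynomial.monom (to_ac (Polynomial.coeff u i)) (q ^ i))"

lemma poly_tw_act_poly: "poly (tw_act_poly q u) x = tw_act q u x"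
  by (simp add: tw_act_poly_def tw_act_def poly_sum poly_monom)

text \<open>For \<open>q \<ge> 2\<close> the exponents \<open>q ^ i\<close> are distinct, so the
  leading coefficient of \<open>u\<close> survives.\<close>

lemma degree_tw_act_poly:
  assumes "q \<ge> 2"
  shows "Polynomial.degree (tw_act_poly q u) \<le> q ^ Polynomial.degree u"
    and "u \<noteq> 0 \<Longrightarrow> Polynomial.degree (tw_act_poly q u) = q ^ Polynomial.degree u"
    and "u \<noteq> 0 \<Longrightarrow> tw_act_poly q u \<noteq> 0"
proof -
  show le: "Polynomial.degree (tw_act_poly q u) \<le> q ^ Polynomial.degree u"
    unfolding tw_act_poly_def
  proof (rule degree_sum_le)
    fix i assume "i \<in> {..Polynomial.degree u}"
    hence "q ^ i \<le> q ^ Polynomial.degree u"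
      using assms by (intro power_increasing) auto
    thus "Polynomial.degree (Polynomial.monom (to_ac (Polynomial.coeff u i)) (q ^ i)) \<le>
        q ^ Polynomial.degree u"
      using degree_monom_le order.trans by blast
  qed auto
  assume "u \<noteq> 0"
  have "Polynomial.coeff (tw_act_poly q u) (q ^ Polynomial.degree u) =
      (\<Sum>i\<le>Polynomial.degree u. if i = Polynomial.degree u then to_ac (lead_coeff u) else 0)"
    unfolding tw_act_poly_def coeff_sum using assms by (intro sum.cong) auto
  also have "\<dots> \<noteq> 0"
    using \<open>u \<noteq> 0\<close> by simp
  finally have nz: "Polynomial.coeff (tw_act_poly q u) (q ^ Polynomial.degree u) \<noteq> 0" .
  thus "Polynomial.degree (tw_act_poly q u) = q ^ Polynomial.degree u"
    using le by (intro order.antisym le_degree)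
  show "tw_act_poly q u \<noteq> 0"
    using nz by auto
qed

lemma card_tw_act_kernel_le:
  assumes "q \<ge> 2" "u \<noteq> 0"
  shows "finite {x. tw_act q u x = 0}" "card {x. tw_act q u x = 0} \<le> q ^ Polynomial.degree u"
  using poly_roots_finite[OF degree_tw_act_poly(3)[OF assms]]
    card_poly_roots_bound[OF degree_tw_act_poly(3)[OF assms]] degree_tw_act_poly(2)[OF assms]
  by (simp_all add: poly_tw_act_poly)

context
  fixes h :: "'f::{field,finite} \<Rightarrow> 'k::field" and q :: nat
  assumes h: "unital_ring_hom h" and q: "CARD('f) = q"
begin

lemma unital_ring_hom_to_ac: "unital_ring_hom (\<lambda>c. to_ac (h c))"
  using h by (auto simp: unital_ring_hom_def)

lemmas to_ac_frobenius = add_power_card_power[OF unital_ring_hom_to_ac, unfolded q]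
  zero_power_card_power[OF unital_ring_hom_to_ac, unfolded q]
  sum_power_card_power[OF unital_ring_hom_to_ac, unfolded q]

lemma tw_act_add_right:
  fixes u :: "'k poly"
  shows "tw_act q u (x + y) = tw_act q u x + tw_act q u y"
  by (simp add: tw_act_def to_ac_frobenius distrib_left sum.distrib)

lemma tw_act_zero_right: "tw_act q (u :: 'k poly) 0 = 0"
  by (simp add: tw_act_def to_ac_frobenius)

lemma tw_act_diff_right:
  fixes u :: "'k poly"
  shows "tw_act q u (x - y) = tw_act q u x - tw_act q u y"
  using tw_act_add_right[of u "x - y" y] by (simp add: algebra_simps)

lemma tw_act_sum_right:
  fixes u :: "'k poly"
  shows "tw_act q u (\<Sum>i\<in>I. g i) = (\<Sum>i\<in>I. tw_act q u (g i))"
  by (induction I rule: infinite_finite_induct) (auto simp: tw_act_add_right tw_act_zero_right)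

text \<open>Additivity lets the \<open>q ^ i\<close>-power pass through the sum for
  \<open>v\<close>; the twist in \<open>tw_mult\<close> is the power it puts on the
  coefficients.\<close>

lemma tw_act_tw_mult:
  fixes u v :: "'k poly"
  shows "tw_act q (tw_mult q u v) x = tw_act q u (tw_act q v x)"
proof -
  have "tw_act q (tw_mult q u v) x = (\<Sum>i\<le>Polynomial.degree u. \<Sum>j\<le>Polynomial.degree v.
      to_ac (Polynomial.coeff u i) * (to_ac (Polynomial.coeff v j) * x ^ (q ^ j)) ^ (q ^ i))"
    unfolding tw_mult_def
    by (simp add: tw_act_sum_left tw_act_monom power_add power_mult power_mult_distrib mult.assoc
        power_commutes flip: power_mult) (simp add: mult.commute)
  also have "\<dots> = tw_act q u (tw_act q v x)"
    by (simp add: tw_act_def to_ac_frobenius sum_distrib_left)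
  finally show ?thesis .
qed

text \<open>Every exponent \<open>q ^ i\<close> with \<open>i > 0\<close> vanishes in the field, so
  the derivative of the linearized polynomial is the constant term of \<open>u\<close>. Being
  nonzero, it rules out multiple roots.\<close>

lemma card_tw_act_kernel_eq:
  fixes u :: "'k poly"
  assumes "Polynomial.coeff u 0 \<noteq> 0"
  shows "card {x. tw_act q u x = 0} = q ^ Polynomial.degree u"
proof -
  have q2: "q \<ge> 2"
    using card_finite_field_ge_2[where ?'a='f] q by simp
  have "u \<noteq> 0"
    using assms by auto
  have "of_nat (q ^ i) = (0 :: 'k alg_closure)" if "i > 0" for i
    using of_nat_card_power_eq_0[OF unital_ring_hom_to_ac that] q by simp
  \<comment> \<open>The rule for higher derivatives of sums, at order 1, serves as the sum rule for
    \<open>pderiv\<close>.\<close>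
  hence "pderiv (tw_act_poly q u) = (\<Sum>i\<le>Polynomial.degree u.
      if i = 0 then Polynomial.monom (to_ac (Polynomial.coeff u 0)) 0 else 0)"
    unfolding tw_act_poly_def higher_pderiv_sum[of 1, simplified]
    by (intro sum.cong) (auto simp: pderiv_monom)
  hence "pderiv (tw_act_poly q u) = [:to_ac (Polynomial.coeff u 0):]"
    by (simp add: monom_0)
  hence "card {x. poly (tw_act_poly q u) x = 0} = Polynomial.degree (tw_act_poly q u)"
    using assms by (intro card_roots_eq_degree degree_tw_act_poly(3)[OF q2 \<open>u \<noteq> 0\<close>]) auto
  thus ?thesis
    by (simp add: poly_tw_act_poly degree_tw_act_poly(2)[OF q2 \<open>u \<noteq> 0\<close>])
qed

end

section \<open>The Drinfeld module\<close>

locale frobenius_drinfeld_module =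
  fixes q r :: nat and \<gamma> :: "'f::{field,finite} poly \<Rightarrow> 'k::{field,finite}"
    and \<phi> :: "'f poly \<Rightarrow> 'k poly"
  assumes card_f: "CARD('f) = q" and card_k: "CARD('k) = q ^ r"
    and \<gamma>: "unital_ring_hom \<gamma>"
    and drinfeld: "drinfeld_module q \<gamma> r \<phi>" and \<phi>_T: "\<phi> [:0, 1:] = Polynomial.monom 1 r"
begin

abbreviation act :: "'f poly \<Rightarrow> 'k alg_closure \<Rightarrow> 'k alg_closure" where
  "act a x \<equiv> tw_act q (\<phi> a) x"

lemma q_ge_2: "q \<ge> 2"
  using card_finite_field_ge_2[where ?'a='f] card_f by simp

lemma r_pos: "r > 0"
  using drinfeld by (auto simp: drinfeld_module_def)

lemma \<phi>_1: "\<phi> 1 = 1"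
  and \<phi>_add: "\<phi> (a + b) = \<phi> a + \<phi> b"
  and \<phi>_mult: "\<phi> (a * b) = tw_mult q (\<phi> a) (\<phi> b)"
  and \<phi>_const: "\<phi> [:c:] = [:\<gamma> [:c:]:]"
  using drinfeld by (auto simp: drinfeld_module_def)

lemma \<phi>_0: "\<phi> 0 = 0"
proof -
  have "\<phi> 0 + \<phi> 0 = \<phi> 0 + 0"
    using \<phi>_add[of 0 0] by simp
  thus ?thesis by (simp only: add_left_cancel)
qed

lemma hom_const: "unital_ring_hom (\<lambda>c. \<gamma> [:c:])"
  using unital_ring_hom_mult[OF \<gamma>, of "[:x:]" "[:y:]" for x y]
    unital_ring_hom_add[OF \<gamma>, of "[:x:]" "[:y:]" for x y] unital_ring_hom_1[OF \<gamma>]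
  by (simp add: unital_ring_hom_def one_pCons)

lemmas frobenius_simps = tw_act_add_right[OF hom_const card_f]
  tw_act_zero_right[OF hom_const card_f] tw_act_diff_right[OF hom_const card_f]
  tw_act_sum_right[OF hom_const card_f]

lemmas act_mult = tw_act_tw_mult[OF hom_const card_f]

lemma \<gamma>_const_power: "\<gamma> [:c:] ^ (q ^ i) = \<gamma> [:c:]"
  using unital_ring_hom_power[OF hom_const, of c "q ^ i"] finite_field_power_card_power[of c i]
  by (simp add: card_f)

lemma k_power: "x ^ (q ^ (r * i)) = (x :: 'k)"
  using finite_field_power_card_power[of x i] by (simp add: card_k power_mult)

text \<open>With \<open>pCons c b\<close> written as \<open>c + T * b\<close>, left multiplication
  by \<open>\<tau> ^ r\<close> only shifts coefficients, as \<open>q ^ r\<close>-th powers are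
  trivial on \<open>'k\<close>. Hence the image of \<open>a\<close> is \<open>a\<close> evaluated at
  \<open>\<tau> ^ r\<close>.\<close>

lemma coeff_\<phi>:
  "Polynomial.coeff (\<phi> a) n = (if r dvd n then \<gamma> [:Polynomial.coeff a (n div r):] else 0)"
proof (induction a arbitrary: n)
  case 0
  thus ?case by (simp add: \<phi>_0 unital_ring_hom_0[OF \<gamma>])
next
  case (pCons c b)
  have "pCons c b = [:c:] + [:0, 1:] * b"
    by simp
  hence "\<phi> (pCons c b) = [:\<gamma> [:c:]:] + tw_mult q (Polynomial.monom 1 r) (\<phi> b)"
    by (metis \<phi>_add \<phi>_mult \<phi>_const \<phi>_T)
  moreover have "Polynomial.coeff (tw_mult q (Polynomial.monom 1 r) (\<phi> b)) n =
      (if r \<le> n then Polynomial.coeff (\<phi> b) (n - r) else 0)"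
  proof -
    have "Polynomial.coeff (tw_mult q (Polynomial.monom 1 r) (\<phi> b)) n =
        (\<Sum>i\<le>n. if i = r then Polynomial.coeff (\<phi> b) (n - r) ^ (q ^ r) else 0)"
    proof (subst coeff_tw_mult)
      show "(\<Sum>i\<le>n. Polynomial.coeff (Polynomial.monom 1 r) i * Polynomial.coeff (\<phi> b) (n - i) ^ q ^ i) =
          (\<Sum>i\<le>n. if i = r then Polynomial.coeff (\<phi> b) (n - r) ^ q ^ r else 0)"
        by (rule sum.cong) auto
    qed (use q_ge_2 in auto)
    thus ?thesis
      using k_power[of _ 1] by simp
  qed
  ultimately have eq: "Polynomial.coeff (\<phi> (pCons c b)) n =
      Polynomial.coeff [:\<gamma> [:c:]:] n + (if r \<le> n then Polynomial.coeff (\<phi> b) (n - r) else 0)"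
    by simp
  consider "n = 0" | "0 < n" "n < r" | "r \<le> n" by linarith
  then show ?case
  proof cases
    case 3
    then obtain k where "n = r + k" using le_Suc_ex by blast
    thus ?thesis
      using eq r_pos pCons.IH by (auto simp: coeff_pCons split: nat.split)
  qed (use eq r_pos in \<open>auto simp: coeff_pCons split: nat.split dest: dvd_imp_le\<close>)
qed

lemma degree_\<phi>: "Polynomial.degree (\<phi> a) = r * Polynomial.degree a"
proof (cases "a = 0")
  case False
  show ?thesis
  proof (rule order.antisym)
    show "Polynomial.degree (\<phi> a) \<le> r * Polynomial.degree a"
    proof (rule degree_le, intro allI impI)
      fix n assume n: "r * Polynomial.degree a < n"
      show "Polynomial.coeff (\<phi> a) n = 0"
        using n r_pos by (auto simp: coeff_\<phi> coeff_eq_0 unital_ring_hom_0[OF \<gamma>] elim!: dvdE)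
    qed
    show "r * Polynomial.degree a \<le> Polynomial.degree (\<phi> a)"
      using False r_pos
      by (intro le_degree) (simp add: coeff_\<phi> unital_ring_hom_field_eq_0_iff[OF hom_const])
  qed
qed (simp add: \<phi>_0)

text \<open>Both products reduce to the same untwisted convolution: the coefficients of
  \<open>\<phi> a\<close> come from \<open>'f\<close> and are fixed by \<open>q\<close>-th powers,
  while only exponents divisible by \<open>r\<close> occur in \<open>\<phi> a\<close>, and these
  twist \<open>'k\<close> trivially.\<close>

lemma tw_mult_\<phi>_commute: "tw_mult q u (\<phi> a) = tw_mult q (\<phi> a) u"
proof (rule poly_eqI)
  fix n
  have "Polynomial.coeff (tw_mult q u (\<phi> a)) n =
      (\<Sum>i\<le>n. Polynomial.coeff u i * Polynomial.coeff (\<phi> a) (n - i))"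
    using q_ge_2
    by (auto simp: coeff_tw_mult coeff_\<phi> \<gamma>_const_power zero_power intro!: sum.cong)
  also have "\<dots> = (\<Sum>i\<le>n. Polynomial.coeff (\<phi> a) i * Polynomial.coeff u (n - i))"
    by (rule sum.reindex_bij_witness[of _ "\<lambda>i. n - i" "\<lambda>i. n - i"]) auto
  also have "\<dots> = Polynomial.coeff (tw_mult q (\<phi> a) u) n"
    using q_ge_2
    by (auto simp: coeff_tw_mult coeff_\<phi> k_power intro!: sum.cong elim!: dvdE)
  finally show "Polynomial.coeff (tw_mult q u (\<phi> a)) n = Polynomial.coeff (tw_mult q (\<phi> a) u) n" .
qed

lemma drinfeld_End_eq: "drinfeld_End q \<phi> = UNIV"
  by (simp add: drinfeld_End_def tw_mult_\<phi>_commute)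

lemma endo_le_eq: "endo_le q \<phi> s = {u. Polynomial.degree u \<le> s}"
  by (auto simp: endo_le_def drinfeld_End_eq)

lemma tw_act_act: "tw_act q u (act a x) = act a (tw_act q u x)"
  by (metis act_mult tw_mult_\<phi>_commute)

sublocale finite_field_poly_module act
proof
  show "act 1 x = x" for x
    by (simp add: \<phi>_1 tw_act_def)
qed (simp_all add: frobenius_simps \<phi>_add tw_act_add_left \<phi>_mult act_mult)

lemma torsion_eq: "torsion q \<phi> p = {x. act p x = 0}"
  by (simp add: torsion_def)

lemma tors_comb_eq: "tors_comb q \<phi> \<beta> a = (\<Sum>x\<in>UNIV. act (a x) (\<beta> x))"
  by (simp add: tors_comb_def)

text \<open>A nonzero constant term of \<open>p\<close> survives in \<open>\<phi> p\<close>, so the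
  linearized polynomial is separable and has as many roots as its degree.\<close>

lemma card_torsion:
  assumes "Polynomial.coeff p 0 \<noteq> 0"
  shows "card (torsion q \<phi> p) = q ^ (r * Polynomial.degree p)"
  unfolding torsion_def using assms
  by (subst card_tw_act_kernel_eq[OF hom_const card_f])
    (simp_all add: coeff_\<phi> unital_ring_hom_field_eq_0_iff[OF hom_const] degree_\<phi>)

lemma torsion_basis_ex:
  assumes "Factorial_Ring.irreducible p" "Polynomial.coeff p 0 \<noteq> 0" "CARD('r::finite) = r"
  shows "\<exists>\<beta> :: 'r \<Rightarrow> 'k alg_closure. torsion_basis q \<phi> p \<beta>"
  unfolding torsion_basis_def torsion_eq tors_comb_eq
  using card_torsion[OF assms(2)]
  by (intro torsion_basis_exists[OF assms(1)])
    (simp add: card_f assms(3) torsion_eq mult.commute flip: power_mult)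

end

section \<open>Coordinates on the torsion of one prime\<close>

locale torsion_coordinates = frobenius_drinfeld_module q r \<gamma> \<phi>
  for q r :: nat and \<gamma> :: "'f::{field,finite} poly \<Rightarrow> 'k::{field,finite}" and \<phi> +
  fixes \<iota> :: "'f \<Rightarrow> 'e::{field,finite}" and p :: "'f poly" and \<sigma> :: "'f poly \<Rightarrow> 'e"
    and \<beta> :: "'r::finite \<Rightarrow> 'k alg_closure"
  assumes residue_iso: "residue_iso \<iota> p \<sigma>" and torsion_basis: "torsion_basis q \<phi> p \<beta>"
begin

lemma \<sigma>_hom: "unital_ring_hom \<sigma>" and \<sigma>_const: "\<sigma> [:c:] = \<iota> c" and \<sigma>_surj: "surj \<sigma>"
  and \<sigma>_eq_0_iff: "\<sigma> a = 0 \<longleftrightarrow> p dvd a"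
  using residue_iso by (auto simp: residue_iso_def)

lemma \<sigma>_inv: "\<sigma> (inv_into UNIV \<sigma> e) = e"
  by (rule surj_f_inv_f[OF \<sigma>_surj])

lemma \<sigma>_eq_iff: "\<sigma> a = \<sigma> b \<longleftrightarrow> p dvd a - b"
  by (simp add: unital_ring_hom_diff[OF \<sigma>_hom] flip: \<sigma>_eq_0_iff)

lemma act_basis: "act p (\<beta> x) = 0"
  using torsion_basis by (auto simp: torsion_basis_def torsion_eq)

text \<open>The linear isomorphism from coordinate space to the torsion given by
  \<open>\<beta>\<close>. Coordinates are lifted along \<open>\<sigma>\<close> by an arbitrary
  preimage, which \<open>tors_comb_eq_vec_comb\<close> shows to be harmless.\<close>

definition vec_comb :: "'e ^ 'r \<Rightarrow> 'k alg_closure" where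
  "vec_comb v = tors_comb q \<phi> \<beta> (\<lambda>x. inv_into UNIV \<sigma> (v $ x))"

lemma tors_comb_eq_vec_comb: "tors_comb q \<phi> \<beta> a = vec_comb (\<chi> x. \<sigma> (a x))"
  unfolding vec_comb_def tors_comb_eq
  by (intro sum.cong scale_cong_dvd[OF act_basis]) (simp_all add: \<sigma>_inv flip: \<sigma>_eq_iff)

lemma tors_comb_torsion: "act p (tors_comb q \<phi> \<beta> a) = 0"
proof -
  have "act p (act b (\<beta> x)) = 0" for b x
    by (metis act_basis tw_act_act tw_act_zero_right[OF hom_const card_f])
  thus ?thesis
    by (simp add: tors_comb_eq frobenius_simps)
qed

lemma vec_comb_torsion: "act p (vec_comb v) = 0"
  unfolding vec_comb_def by (rule tors_comb_torsion)

lemma vec_comb_surj: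
  assumes "act p \<alpha> = 0"
  obtains v where "\<alpha> = vec_comb v"
proof -
  have "\<alpha> \<in> torsion q \<phi> p"
    using assms by (simp add: torsion_eq)
  then obtain a where "\<alpha> = tors_comb q \<phi> \<beta> a"
    using torsion_basis unfolding torsion_basis_def by blast
  thus thesis
    using that by (simp add: tors_comb_eq_vec_comb)
qed

lemma vec_comb_inj: "vec_comb v = vec_comb w \<Longrightarrow> v = w"
proof -
  assume "vec_comb v = vec_comb w"
  hence "tors_comb q \<phi> \<beta> (\<lambda>x. inv_into UNIV \<sigma> (v $ x) - inv_into UNIV \<sigma> (w $ x)) = 0"
    by (simp add: vec_comb_def tors_comb_eq scale_left_diff_distrib sum_subtractf)
  hence "p dvd inv_into UNIV \<sigma> (v $ x) - inv_into UNIV \<sigma> (w $ x)" for x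
    using torsion_basis unfolding torsion_basis_def by blast
  thus "v = w"
    by (simp add: vec_eq_iff \<sigma>_inv flip: \<sigma>_eq_iff)
qed

lemma vec_comb_add: "vec_comb (v + w) = vec_comb v + vec_comb w"
proof -
  have "vec_comb v + vec_comb w = tors_comb q \<phi> \<beta> (\<lambda>x. inv_into UNIV \<sigma> (v $ x) + inv_into UNIV \<sigma> (w $ x))"
    by (simp add: vec_comb_def tors_comb_eq scale_left_distrib sum.distrib)
  also have "\<dots> = vec_comb (v + w)"
    by (simp add: tors_comb_eq_vec_comb unital_ring_hom_add[OF \<sigma>_hom] \<sigma>_inv plus_vec_def)
  finally show ?thesis ..
qed

lemma vec_comb_0: "vec_comb 0 = 0"
  using vec_comb_add[of 0 0] by (metis add.right_neutral add_left_cancel)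

lemma vec_comb_sum: "vec_comb (sum f A) = (\<Sum>x\<in>A. vec_comb (f x))"
  by (induction A rule: infinite_finite_induct) (auto simp: vec_comb_0 vec_comb_add)

lemma act_vec_comb: "act a (vec_comb v) = vec_comb (\<chi> x. \<sigma> a * v $ x)"
proof -
  have "act a (vec_comb v) = tors_comb q \<phi> \<beta> (\<lambda>x. a * inv_into UNIV \<sigma> (v $ x))"
    by (simp add: vec_comb_def tors_comb_eq scale_sum_right)
  thus ?thesis
    by (simp add: tors_comb_eq_vec_comb unital_ring_hom_mult[OF \<sigma>_hom] \<sigma>_inv)
qed

abbreviation matrix_of :: "'k poly \<Rightarrow> 'e ^ 'r ^ 'r" where
  "matrix_of u \<equiv> endo_matrix q \<phi> \<sigma> \<beta> u"

text \<open>\<open>u\<close> commutes with \<open>act p\<close>, hence preserves the torsion; so the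
  coefficients that \<open>endo_matrix\<close> selects by \<open>SOME\<close> exist.\<close>

lemma tw_act_basis: "tw_act q u (\<beta> y) = vec_comb (column y (matrix_of u))"
proof -
  have "act p (tw_act q u (\<beta> y)) = 0"
    by (metis act_basis tw_act_act tw_act_zero_right[OF hom_const card_f])
  hence "\<exists>a. tw_act q u (\<beta> y) = tors_comb q \<phi> \<beta> a"
    using torsion_basis by (auto simp: torsion_basis_def torsion_eq)
  hence "tw_act q u (\<beta> y) = tors_comb q \<phi> \<beta> (SOME a. tw_act q u (\<beta> y) = tors_comb q \<phi> \<beta> a)"
    by (rule someI_ex)
  thus ?thesis
    by (simp add: tors_comb_eq_vec_comb endo_matrix_def column_def)
qed

text \<open>Commuting with \<open>act\<close> makes \<open>u\<close> linear over the residue field,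
  so its values on the basis determine it.\<close>

lemma tw_act_vec_comb: "tw_act q u (vec_comb v) = vec_comb (matrix_of u *v v)"
proof -
  have "tw_act q u (vec_comb v) = (\<Sum>y\<in>UNIV. act (inv_into UNIV \<sigma> (v $ y)) (tw_act q u (\<beta> y)))"
    by (simp add: vec_comb_def tors_comb_eq frobenius_simps tw_act_act)
  also have "\<dots> = vec_comb (\<Sum>y\<in>UNIV. \<chi> x. v $ y * column y (matrix_of u) $ x)"
    by (simp add: tw_act_basis act_vec_comb \<sigma>_inv vec_comb_sum)
  also have "(\<Sum>y\<in>UNIV. \<chi> x. v $ y * column y (matrix_of u) $ x) = matrix_of u *v v"
    by (simp add: vec_eq_iff matrix_vector_mult_def column_def mult.commute)
  finally show ?thesis .
qed

text \<open>Coordinates are unique, so matrices can be identified by their columns without opening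
  the \<open>SOME\<close> in \<open>endo_matrix\<close>.\<close>

lemma matrix_of_eqI:
  assumes "\<And>y. tw_act q u (\<beta> y) = vec_comb (column y M)"
  shows "matrix_of u = M"
proof -
  have "column y (matrix_of u) = column y M" for y
    using assms[of y] by (intro vec_comb_inj) (simp add: tw_act_basis)
  thus ?thesis
    by (simp add: vec_eq_iff column_def)
qed

lemma matrix_of_add: "matrix_of (u + v) = matrix_of u + matrix_of v"
proof (rule matrix_of_eqI)
  fix y
  have "column y (matrix_of u + matrix_of v) = column y (matrix_of u) + column y (matrix_of v)"
    by (simp add: column_def vec_eq_iff)
  thus "tw_act q (u + v) (\<beta> y) = vec_comb (column y (matrix_of u + matrix_of v))"
    by (simp add: tw_act_add_left tw_act_basis vec_comb_add)
qed

lemma matrix_of_smult: "matrix_of (smult (\<gamma> [:c:]) u) = (\<chi> x y. \<iota> c * matrix_of u $ x $ y)"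
proof (rule matrix_of_eqI)
  fix y
  \<comment> \<open>A constant of \<open>'f\<close> acts as the polynomial \<open>[:c:]\<close>,
    hence on coordinates as multiplication by \<open>\<sigma> [:c:] = \<iota> c\<close>.\<close>
  have "tw_act q (smult (\<gamma> [:c:]) u) (\<beta> y) = act [:c:] (tw_act q u (\<beta> y))"
    by (simp add: tw_act_smult \<phi>_const tw_act_def[of q "[:_:]"])
  thus "tw_act q (smult (\<gamma> [:c:]) u) (\<beta> y) =
      vec_comb (column y (\<chi> x y. \<iota> c * matrix_of u $ x $ y))"
    by (simp add: tw_act_basis act_vec_comb \<sigma>_const column_def)
qed

text \<open>\<open>vec_comb\<close> carries the kernel of the matrix bijectively onto the kernel of
  \<open>u\<close> in the torsion, so \<open>card_matrix_kernel_ge\<close> transfers.\<close>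

lemma card_torsion_kernel_ge:
  "CARD('e) ^ CARD('r) \<le>
    card {\<alpha> \<in> torsion q \<phi> p. tw_act q u \<alpha> = 0} * CARD('e) ^ rank (matrix_of u)"
proof -
  have "{\<alpha> \<in> torsion q \<phi> p. tw_act q u \<alpha> = 0} = vec_comb ` {v. matrix_of u *v v = 0}"
  proof (intro equalityI subsetI)
    fix \<alpha> assume \<alpha>: "\<alpha> \<in> {\<alpha> \<in> torsion q \<phi> p. tw_act q u \<alpha> = 0}"
    then obtain v where v: "\<alpha> = vec_comb v"
      using vec_comb_surj by (auto simp: torsion_eq)
    hence "vec_comb (matrix_of u *v v) = vec_comb 0"
      using \<alpha> by (simp add: tw_act_vec_comb vec_comb_0)
    thus "\<alpha> \<in> vec_comb ` {v. matrix_of u *v v = 0}"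
      using v vec_comb_inj by blast
  next
    fix \<alpha> assume "\<alpha> \<in> vec_comb ` {v. matrix_of u *v v = 0}"
    thus "\<alpha> \<in> {\<alpha> \<in> torsion q \<phi> p. tw_act q u \<alpha> = 0}"
      by (auto simp: tw_act_vec_comb[of u] vec_comb_0 torsion_eq vec_comb_torsion)
  qed
  moreover have "inj_on vec_comb {v. matrix_of u *v v = 0}"
    by (intro inj_onI vec_comb_inj)
  ultimately show ?thesis
    using card_matrix_kernel_ge[of "matrix_of u"] by (simp add: card_image)
qed

end

section \<open>The code\<close>

lemma wt_SR_0: "wt_SR (0 :: 'e::field ^ 'r::finite ^ 'r ^ 'l::finite) = 0"
  using rank_le_card_nonzero_rows[of "0 :: 'e ^ 'r ^ 'r"] by (simp add: wt_SR_def)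

text \<open>The Singleton bound: by pigeonhole, two codewords agree on \<open>n\<close> prescribed rows.\<close>

lemma exists_low_weight:
  fixes C :: "('e::{field,finite} ^ 'r::finite ^ 'r ^ 'l::finite) set"
  assumes diff: "\<And>M N. M \<in> C \<Longrightarrow> N \<in> C \<Longrightarrow> M - N \<in> C"
    and n: "n \<le> CARD('l) * CARD('r)" and card: "CARD('e) ^ (CARD('r) * n) < card C"
  shows "\<exists>M\<in>C-{0}. wt_SR M \<le> CARD('l) * CARD('r) - n"
proof -
  obtain S :: "('l \<times> 'r) set" where S: "card S = n"
    using obtain_subset_with_card_n[of n "UNIV :: ('l \<times> 'r) set"] n by auto
  define g where "g = (\<lambda>M :: 'e ^ 'r ^ 'r ^ 'l. \<lambda>(i, x)\<in>S. M $ i $ x)"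
  have "card (g ` C) \<le> card (S \<rightarrow>\<^sub>E (UNIV :: ('e ^ 'r) set))"
    by (intro card_mono finite_PiE) (auto simp: g_def)
  also have "\<dots> = CARD('e) ^ (CARD('r) * n)"
    by (simp add: card_PiE S power_mult)
  also have "\<dots> < card C"
    by (rule card)
  finally have "\<not> inj_on g C"
    by (rule pigeonhole)
  then obtain M N where MN: "M \<in> C" "N \<in> C" "M \<noteq> N" "g M = g N"
    by (auto simp: inj_on_def)
  have zero: "(M - N) $ i $ x = 0" if "(i, x) \<in> S" for i x
    using fun_cong[OF MN(4), of "(i, x)"] that by (simp add: g_def)
  \<comment> \<open>The rank of each block is at most its number of nonzero rows, and all nonzero
    rows of the difference lie outside \<open>S\<close>.\<close>
  have "wt_SR (M - N) \<le> (\<Sum>i\<in>UNIV. card {x. (M - N) $ i $ x \<noteq> 0})"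
    unfolding wt_SR_def by (intro sum_mono rank_le_card_nonzero_rows)
  also have "\<dots> = card (SIGMA i:UNIV. {x. (M - N) $ i $ x \<noteq> 0})"
    by simp
  also have "\<dots> \<le> card (UNIV - S)"
    using zero by (intro card_mono) auto
  also have "\<dots> = CARD('l) * CARD('r) - n"
    by (simp add: card_Diff_subset S)
  finally show ?thesis
    using MN diff by (intro bexI[of _ "M - N"]) auto
qed

lemma vector_space_base_scale:
  assumes "unital_ring_hom \<iota>"
  shows "vector_space (base_scale \<iota> :: 'f::field \<Rightarrow> 'e::field ^ 'r::finite ^ 'r ^ 'l::finite \<Rightarrow> _)"
  by standard (simp_all add: base_scale_def vec_eq_iff algebra_simps
      unital_ring_hom_add[OF assms] unital_ring_hom_mult[OF assms] unital_ring_hom_1[OF assms])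

section \<open>Distance and dimension of the code\<close>

locale msrd_setup = frobenius_drinfeld_module q r \<gamma> \<phi>
  for q r :: nat and \<gamma> :: "'f::{field,finite} poly \<Rightarrow> 'k::{field,finite}" and \<phi> +
  fixes \<iota> :: "'f \<Rightarrow> 'e::{field,finite}" and m t :: nat
    and Q :: "'l::finite \<Rightarrow> 'f poly" and \<sigma> :: "'l \<Rightarrow> 'f poly \<Rightarrow> 'e"
    and \<beta> :: "'l \<Rightarrow> 'r::finite \<Rightarrow> 'k alg_closure"
  assumes card_e: "CARD('e) = q ^ m" and card_r: "CARD('r) = r" and \<iota>: "unital_ring_hom \<iota>"
    and inj_Q: "inj Q" and irred: "\<And>i. Factorial_Ring.irreducible (Q i)"
    and monic: "\<And>i. lead_coeff (Q i) = 1" and degree_Q: "\<And>i. Polynomial.degree (Q i) = m"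
    and t: "1 \<le> t" "t \<le> CARD('l) * r"
    and residue_iso': "\<And>i. residue_iso \<iota> (Q i) (\<sigma> i)"
    and torsion_basis': "\<And>i. torsion_basis q \<phi> (Q i) (\<beta> i)"
begin

sublocale coords: torsion_coordinates q r \<gamma> \<phi> \<iota> "Q i" "\<sigma> i" "\<beta> i" for i
  by standard (use residue_iso' torsion_basis' in auto)

definition code_map :: "'k poly \<Rightarrow> 'e ^ 'r ^ 'r ^ 'l" where
  "code_map u = (\<chi> i. coords.matrix_of i u)"

lemma m_pos: "m > 0"
  using irreducible_poly_degree_pos[OF irred] degree_Q by metis

lemma Q_coprime: "i \<noteq> j \<Longrightarrow> \<exists>c. Q i dvd Q j * c - 1"
proof -
  assume "i \<noteq> j"
  have "\<not> Q i dvd Q j"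
    using irreducible_monic_dvd_imp_eq[OF irred _ monic monic, of i j] \<open>i \<noteq> j\<close> inj_Q m_pos
    by (auto simp: degree_Q inj_eq)
  thus ?thesis
    using residue_inverse[OF irred] by metis
qed

text \<open>Adding one element from each kernel \<open>K i\<close> gives distinct roots of
  \<open>u\<close>, of which there are at most \<open>q ^ degree u\<close>; the ranks bound each
  \<open>K i\<close> from below. The additive form avoids truncated subtraction.\<close>

lemma degree_plus_weight_ge:
  assumes "u \<noteq> 0"
  shows "m * (CARD('l) * r) \<le> Polynomial.degree u + m * wt_SR (code_map u)"
proof -
  define K where "K = (\<lambda>i. {\<alpha> \<in> torsion q \<phi> (Q i). tw_act q u \<alpha> = 0})"
  define Z where "Z = {\<alpha>. tw_act q u \<alpha> = 0}"
  define F where "F = (\<lambda>f :: 'l \<Rightarrow> 'k alg_closure. \<Sum>i\<in>UNIV. f i)"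
  \<comment> \<open>Equal sums agree in every component because the torsion modules of the coprime
    \<open>Q i\<close> are independent.\<close>
  have inj: "inj_on F (Pi\<^sub>E UNIV K)"
  proof (intro inj_onI ext)
    fix f g i assume fg: "f \<in> Pi\<^sub>E UNIV K" "g \<in> Pi\<^sub>E UNIV K" and "F f = F g"
    have "f i - g i = 0"
    proof (rule torsion_sum_eq_0[of UNIV Q "\<lambda>i. f i - g i"])
      fix j
      have "f j \<in> K j" "g j \<in> K j" using fg by auto
      thus "act (Q j) (f j - g j) = 0"
        by (simp add: K_def torsion_eq frobenius_simps)
    next
      show "(\<Sum>i\<in>UNIV. f i - g i) = 0"
        using \<open>F f = F g\<close> by (simp add: F_def sum_subtractf)
    qed (use Q_coprime in auto)
    thus "f i = g i" by simp
  qed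
  have "F f \<in> Z" if "f \<in> Pi\<^sub>E UNIV K" for f
  proof -
    have "tw_act q u (f i) = 0" for i
      using that by (auto simp: K_def)
    thus ?thesis by (simp add: F_def Z_def frobenius_simps)
  qed
  hence "card (Pi\<^sub>E UNIV K) \<le> card Z"
    using inj card_tw_act_kernel_le(1)[OF q_ge_2 assms] by (intro card_inj_on_le) (auto simp: Z_def)
  hence prod_le: "(\<Prod>i\<in>UNIV. card (K i)) \<le> q ^ Polynomial.degree u"
    using card_tw_act_kernel_le(2)[OF q_ge_2 assms] by (simp add: card_PiE Z_def)
  have "q ^ (m * (CARD('l) * r)) = (\<Prod>i\<in>(UNIV :: 'l set). CARD('e) ^ CARD('r))"
    by (simp add: card_e card_r mult_ac flip: power_mult)
  also have "\<dots> \<le> (\<Prod>i\<in>UNIV. card (K i) * CARD('e) ^ rank (coords.matrix_of i u))"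
    by (intro prod_mono) (use coords.card_torsion_kernel_ge in \<open>auto simp: K_def\<close>)
  also have "\<dots> = (\<Prod>i\<in>UNIV. card (K i)) * q ^ (m * wt_SR (code_map u))"
    by (simp add: prod.distrib card_e wt_SR_def code_map_def power_sum sum_distrib_left
        flip: power_mult)
  also have "\<dots> \<le> q ^ Polynomial.degree u * q ^ (m * wt_SR (code_map u))"
    using prod_le by simp
  also have "\<dots> = q ^ (Polynomial.degree u + m * wt_SR (code_map u))"
    by (simp add: power_add)
  finally show ?thesis
    using q_ge_2 by (simp add: power_increasing_iff)
qed

text \<open>The degree is strictly below \<open>t * m\<close>, so cancelling \<open>m\<close> leaves
  a strict inequality, which accounts for the \<open>+ 1\<close>;
  \<open>t \<le> CARD('l) * r\<close> keeps the subtraction from truncating.\<close>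

lemma weight_ge:
  assumes "u \<noteq> 0" "Polynomial.degree u < t * m"
  shows "CARD('l) * r - t + 1 \<le> wt_SR (code_map u)"
proof -
  have "m * (CARD('l) * r) < m * (t + wt_SR (code_map u))"
    using degree_plus_weight_ge[OF assms(1)] assms(2) by (simp add: algebra_simps)
  hence "CARD('l) * r < t + wt_SR (code_map u)"
    by simp
  thus ?thesis
    using t(2) by linarith
qed

text \<open>The strict bound agrees with \<open>\<le> t * m - 1\<close> because
  \<open>t * m > 0\<close>, and it matches the form of \<open>card_poly_degree_less\<close>.\<close>

definition code :: "('e ^ 'r ^ 'r ^ 'l) set" where
  "code = code_map ` {u. Polynomial.degree u < t * m}"

lemma msrd_code_eq: "msrd_code q \<phi> \<sigma> \<beta> (t * m - 1) = code"
proof -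
  have "t * m > 0" using t m_pos by simp
  hence "endo_le q \<phi> (t * m - 1) = {u. Polynomial.degree u < t * m}"
    unfolding endo_le_eq by (intro Collect_cong) linarith
  thus ?thesis
    by (simp add: msrd_code_def code_def code_map_def[abs_def])
qed

lemma code_map_add: "code_map (u + v) = code_map u + code_map v"
  by (simp add: code_map_def vec_eq_iff coords.matrix_of_add)

lemma code_map_0: "code_map 0 = 0"
  using code_map_add[of 0 0] by (metis add.right_neutral add_left_cancel)

lemma code_map_diff: "code_map (u - v) = code_map u - code_map v"
  using code_map_add[of "u - v" v] by (simp add: algebra_simps)

lemma code_map_smult: "code_map (smult (\<gamma> [:c:]) u) = base_scale \<iota> c (code_map u)"
  by (simp add: code_map_def vec_eq_iff coords.matrix_of_smult base_scale_def)

lemma subspace_code: "module.subspace (base_scale \<iota>) code"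
proof -
  interpret B: vector_space "base_scale \<iota> :: 'f \<Rightarrow> 'e ^ 'r ^ 'r ^ 'l \<Rightarrow> _"
    by (rule vector_space_base_scale[OF \<iota>])
  have "t * m > 0" using t m_pos by simp
  show ?thesis
    unfolding B.subspace_def code_def
  proof (intro conjI ballI allI)
    show "0 \<in> code_map ` {u. Polynomial.degree u < t * m}"
      using \<open>t * m > 0\<close> by (intro image_eqI[of _ _ 0]) (auto simp: code_map_0)
  qed (auto simp: degree_add_less simp flip: code_map_add code_map_smult
      intro: le_less_trans[OF degree_smult_le])
qed

lemma code_diff: "M \<in> code \<Longrightarrow> N \<in> code \<Longrightarrow> M - N \<in> code"
  by (auto simp: code_def degree_diff_less simp flip: code_map_diff)

text \<open>Distinct polynomials with the same image would have a nonzero difference whose image has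
  weight 0, against \<open>weight_ge\<close>. Hence it suffices to count polynomials.\<close>

lemma card_code: "card code = q ^ (m * r * t)"
proof -
  have "t * m > 0" using t m_pos by simp
  have "inj_on code_map {u. Polynomial.degree u < t * m}"
  proof (rule inj_onI, rule ccontr)
    fix u v assume uv: "u \<in> {u. Polynomial.degree u < t * m}" "v \<in> {u. Polynomial.degree u < t * m}"
      "code_map u = code_map v" "u \<noteq> v"
    hence "code_map (u - v) = 0" by (simp add: code_map_diff)
    thus False
      using weight_ge[of "u - v"] uv by (auto simp: wt_SR_0 degree_diff_less)
  qed
  hence "card code = card {u :: 'k poly. Polynomial.degree u < t * m}"
    by (simp add: code_def card_image)
  also have "\<dots> = q ^ (m * r * t)"
    by (subst card_poly_degree_less(1)[OF \<open>t * m > 0\<close>]) (simp add: card_k mult_ac flip: power_mult)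
  finally show ?thesis .
qed

lemma base_dim_code: "base_dim \<iota> code = m * r * t"
proof -
  have "card code = CARD('f) ^ base_dim \<iota> code"
    unfolding base_dim_def
    by (intro card_finite_subspace vector_space_base_scale \<iota> subspace_code finite)
  thus ?thesis
    using q_ge_2 by (simp add: card_code card_f)
qed

lemma code_nontrivial: "code \<noteq> {0}"
proof
  assume "code = {0}"
  hence "q ^ (m * r * t) = 1"
    using card_code by simp
  thus False
    using q_ge_2 m_pos r_pos t by auto
qed

lemma d_SR_code: "d_SR code = CARD('l) * r - t + 1"
  unfolding d_SR_def
proof (rule Min_eqI)
  fix w assume "w \<in> wt_SR ` (code - {0})"
  then obtain u where u: "Polynomial.degree u < t * m" "code_map u \<noteq> 0" "w = wt_SR (code_map u)"
    by (auto simp: code_def)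
  thus "CARD('l) * r - t + 1 \<le> w"
    using weight_ge[of u] code_map_0 by auto
next
  \<comment> \<open>Prescribing \<open>t - 1\<close> rows leaves
    \<open>q ^ (m * r * (t - 1))\<close> patterns, fewer than the \<open>q ^ (m * r * t)\<close>
    codewords.\<close>
  have "CARD('e) ^ (CARD('r) * (t - 1)) < card code"
    using q_ge_2 m_pos r_pos t
    by (auto simp: card_code card_e card_r simp flip: power_mult intro!: power_strict_increasing)
  then obtain M where M: "M \<in> code - {0}" "wt_SR M \<le> CARD('l) * CARD('r) - (t - 1)"
    using exists_low_weight[of code "t - 1"] code_diff t by (force simp: card_r)
  then obtain u where u: "Polynomial.degree u < t * m" "M = code_map u"
    by (auto simp: code_def)
  hence "CARD('l) * r - t + 1 \<le> wt_SR M"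
    using weight_ge[of u] M code_map_0 by auto
  \<comment> \<open>Upper and lower bound meet: \<open>1 \<le> t\<close> and
    \<open>t \<le> CARD('l) * r\<close> make the two truncated expressions equal.\<close>
  hence "wt_SR M = CARD('l) * r - t + 1"
    using M(2) t by (simp add: card_r)
  thus "CARD('l) * r - t + 1 \<in> wt_SR ` (code - {0})"
    using M(1) by (metis image_eqI)
qed simp

lemma additive_MSRD_code: "additive_MSRD \<iota> m code"
  unfolding additive_MSRD_def additive_code_def
  using subspace_code code_nontrivial t by (simp add: base_dim_code d_SR_code card_r)

end

text \<open>Existence comes first, so that the claim about all choices of \<open>\<sigma>\<close>
  and \<open>\<beta>\<close> is not vacuous; quantifying over all of them shows that the parameters
  do not depend on the choice.\<close>

theorem theorem3p9:
  fixes q r m l t s :: nat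
    and \<gamma> :: "'f::{field,finite} poly \<Rightarrow> 'k::{field,finite}"
    and \<iota> :: "'f \<Rightarrow> 'e::{field,finite}"
    and \<phi> :: "'f poly \<Rightarrow> 'k poly"
    and Q :: "'l::finite \<Rightarrow> 'f poly"
  assumes "CARD('f) = q" and "CARD('k) = q ^ r" and "CARD('e) = q ^ m"
    and "CARD('r::finite) = r" and "CARD('l) = l"
    and "unital_ring_hom \<gamma>" and "\<gamma> [:0, 1:] = 0"
    and "unital_ring_hom \<iota>"
    and "drinfeld_module q \<gamma> r \<phi>" and "\<phi> [:0, 1:] = Polynomial.monom 1 r"
    and "l \<ge> 1" and "m \<ge> 1"
    and "inj Q"
    and "\<And>i. Factorial_Ring.irreducible (Q i)" and "\<And>i. lead_coeff (Q i) = 1"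
    and "\<And>i. Polynomial.degree (Q i) = m" and "\<And>i. Q i \<noteq> [:0, 1:]"
    and "1 \<le> t" and "t \<le> l * r" and "s = t * m - 1"
  shows "(\<exists>(\<sigma> :: 'l \<Rightarrow> 'f poly \<Rightarrow> 'e) (\<beta> :: 'l \<Rightarrow> 'r \<Rightarrow> 'k alg_closure).
            \<forall>i. residue_iso \<iota> (Q i) (\<sigma> i) \<and> torsion_basis q \<phi> (Q i) (\<beta> i))
       \<and> (\<forall>(\<sigma> :: 'l \<Rightarrow> 'f poly \<Rightarrow> 'e) (\<beta> :: 'l \<Rightarrow> 'r \<Rightarrow> 'k alg_closure).
            (\<forall>i. residue_iso \<iota> (Q i) (\<sigma> i) \<and> torsion_basis q \<phi> (Q i) (\<beta> i)) \<longrightarrow>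
            (let C = msrd_code q \<phi> \<sigma> \<beta> s in
               additive_MSRD \<iota> m C \<and>
               d_SR C = l * r - t + 1 \<and>
               base_dim \<iota> C = m * r * t))"
proof (intro conjI allI impI)
  interpret frobenius_drinfeld_module q r \<gamma> \<phi>
    by standard (use assms in auto)
  \<comment> \<open>A vanishing constant term would make \<open>T\<close> divide \<open>Q i\<close>,
    hence equal it. The nonzero constant term gives the torsion its full size.\<close>
  have "Polynomial.coeff (Q i) 0 \<noteq> 0" for i
  proof
    assume "Polynomial.coeff (Q i) 0 = 0"
    hence "[:0, 1:] dvd Q i"
      by (simp add: poly_eq_0_iff_dvd[of _ 0, simplified, symmetric] poly_0_coeff_0)
    hence "[:0, 1:] = Q i"
      using assms by (intro irreducible_monic_dvd_imp_eq) auto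
    thus False
      using assms by metis
  qed
  hence "\<exists>\<beta> :: 'r \<Rightarrow> 'k alg_closure. torsion_basis q \<phi> (Q i) \<beta>" for i
    using assms by (intro torsion_basis_ex) auto
  moreover have "\<exists>\<sigma>. residue_iso \<iota> (Q i) \<sigma>" for i
    using assms by (intro residue_iso_exists) auto
  ultimately have "\<forall>i. \<exists>\<sigma> \<beta>. residue_iso \<iota> (Q i) \<sigma> \<and> torsion_basis q \<phi> (Q i) (\<beta> :: 'r \<Rightarrow> _)"
    by blast
  thus "\<exists>(\<sigma> :: 'l \<Rightarrow> 'f poly \<Rightarrow> 'e) (\<beta> :: 'l \<Rightarrow> 'r \<Rightarrow> 'k alg_closure).
      \<forall>i. residue_iso \<iota> (Q i) (\<sigma> i) \<and> torsion_basis q \<phi> (Q i) (\<beta> i)"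
    by metis
next
  fix \<sigma> :: "'l \<Rightarrow> 'f poly \<Rightarrow> 'e" and \<beta> :: "'l \<Rightarrow> 'r \<Rightarrow> 'k alg_closure"
  assume "\<forall>i. residue_iso \<iota> (Q i) (\<sigma> i) \<and> torsion_basis q \<phi> (Q i) (\<beta> i)"
  then interpret msrd_setup q r \<gamma> \<phi> \<iota> m t Q \<sigma> \<beta>
    by unfold_locales (use assms in auto)
  show "let C = msrd_code q \<phi> \<sigma> \<beta> s in
      additive_MSRD \<iota> m C \<and> d_SR C = l * r - t + 1 \<and> base_dim \<iota> C = m * r * t"
    unfolding \<open>s = t * m - 1\<close> msrd_code_eq Let_def
    using additive_MSRD_code d_SR_code base_dim_code \<open>CARD('l) = l\<close> by simp
qed

end
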